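(* Let $F$ be a $4$-regular graph, let $P$ be a circuit partition of $F$, let $D$ be a directed version of $\mathrm{Tch}(P)$, and let $\Gamma$ be an integral cycle basis of $F-E$, where $E\subseteq E(F)$ is based in $F$. Then $\mathrm{CM}(\mathrm{Tch}(P),\pi_P(\Gamma),D)$ is square and has determinant $-1$, $0$, or $1$.
   Context: Graphs: $G=(V,H,E,\epsilon)$ with finite sets of vertices $V$ and half-edges $H$, a partition $E$ of $H$ into unordered pairs (edges), and $\epsilon:H\to V$; loops and multiple edges allowed. $G-E'$ deletes the edges of $E'$. $E'\subseteq E(G)$ is based in $G$ if it contains exactly one edge of each connected component of $G$. A directed version orders each edge as (tail, head). A single transition is an unordered pair of distinct half-edges incident with a common vertex; a directed single transition is such an ordered pair. A closed walk is a sequence $((h_1,h_2),\dots,(h_{n-1},h_n))$ of directed single transitions with $\{h_2,h_3\},\{h_4,h_5\},\dots,\{h_n,h_1\}$ edges, up to cyclic shift. $\sigma(D,W)\in\mathbb Z^{E}$ counts, at each edge, traversals by $W$ along its direction in $D$ minus traversals against it. A circuit is a nonempty closed walk using each half-edge at most once, orientation forgotten. The cycle space of $D$ is the right null space over $\mathbb Q$ of its vertex-edge incidence matrix. A cycle basis is a set $B$ of closed walks such that the $\sigma(D,W)$, $W\in B$, are pairwise distinct and form a basis of the cycle space; it is integral if every $\sigma(D,W)$, $W$ a closed walk, lies in the $\mathbb Z$-span of $\{\sigma(D,W'):W'\in B\}$. $\mathrm{CM}(G,\Gamma,D)$ is the matrix with rows indexed by $\Gamma$ and columns by $E(G)$,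 whose row for $W$ is $\sigma(D,W)$ (rows and columns unordered; the determinant is defined up to sign). $F$ is $4$-regular if every vertex is incident with exactly $4$ half-edges. A transition at $v$ is a partition of the four half-edges at $v$ into two single transitions. A circuit partition $P$ is a set of circuits of $F$ such that every half-edge lies in exactly one single transition of exactly one circuit of $P$; $\tau(P)$ is the set of transitions both of whose single transitions occur in circuits of $P$. The touch-graph $\mathrm{Tch}(P)$ has vertex set $P$, half-edge set the set of single transitions occurring in circuits of $P$, edge set $\tau(P)$, and maps each single transition to the circuit containing it. For a closed walk $W$ of $F$, $\pi_P(W)$ is obtained by replacing each directed single transition $(h,h')$ of $W$ by $(s,s')$, where $s,s'$ are the single transitions of circuits of $P$ containing $h,h'$, and deleting pairs with $s=s'$; it is a closed walk of $\mathrm{Tch}(P)$ in which each remaining $(s,s')$ traverses edge $\{s,s'\}$ from half-edge $s$ to half-edge $s'$. $\pi_P(\Gamma)$ is the multiset $\{\pi_P(W):W\in\Gamma\}$ (rows indexed by $\Gamma$). *)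

theory Defs
  imports Main "Jordan_Normal_Form.Determinant"
begin

record ('v,'h) hgraph =
  verts :: "'v set"
  hes   :: "'h set"
  edges :: "'h set set"
  inc   :: "'h \<Rightarrow> 'v"

definition wf_graph :: "('v,'h) hgraph \<Rightarrow> bool" where
  "wf_graph G \<longleftrightarrow> finite (verts G) \<and> finite (hes G)
     \<and> (\<forall>e\<in>edges G. \<exists>a b. a \<noteq> b \<and> e = {a,b})
     \<and> \<Union>(edges G) = hes G
     \<and> (\<forall>e\<in>edges G. \<forall>e'\<in>edges G. e \<noteq> e' \<longrightarrow> e \<inter> e' = {})
     \<and> inc G ` hes G \<subseteq> verts G"

definition del_edges :: "('v,'h) hgraph \<Rightarrow> 'h set set \<Rightarrow> ('v,'h) hgraph" where
  "del_edges G E' = \<lparr> verts = verts G, hes = hes G - \<Union>(E' \<inter> edges G),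
                      edges = edges G - E', inc = inc G \<rparr>"

definition adj :: "('v,'h) hgraph \<Rightarrow> 'v \<Rightarrow> 'v \<Rightarrow> bool" where
  "adj G u v \<longleftrightarrow> (\<exists>e\<in>edges G. \<exists>a b. e = {a,b} \<and> inc G a = u \<and> inc G b = v)"

definition reach :: "('v,'h) hgraph \<Rightarrow> 'v \<Rightarrow> 'v \<Rightarrow> bool" where
  "reach G = (adj G)\<^sup>*\<^sup>*"

definition based :: "('v,'h) hgraph \<Rightarrow> 'h set set \<Rightarrow> bool" where
  "based G E' \<longleftrightarrow> E' \<subseteq> edges G \<and>
     (\<forall>v\<in>verts G. \<exists>!e. e \<in> E' \<and> (\<exists>h\<in>e. reach G v (inc G h)))"

definition four_regular :: "('v,'h) hgraph \<Rightarrow> bool" where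
  "four_regular G \<longleftrightarrow> (\<forall>v\<in>verts G. card {h\<in>hes G. inc G h = v} = 4)"

text \<open>Directed versions: each edge is ordered as (tail, head).\<close>
definition directed_version :: "('v,'h) hgraph \<Rightarrow> ('h set \<Rightarrow> 'h \<times> 'h) \<Rightarrow> bool" where
  "directed_version G D \<longleftrightarrow> (\<forall>e\<in>edges G. e = {fst (D e), snd (D e)})"

definition dsingle_trans :: "('v,'h) hgraph \<Rightarrow> 'h \<times> 'h \<Rightarrow> bool" where
  "dsingle_trans G p \<longleftrightarrow> fst p \<in> hes G \<and> snd p \<in> hes G \<and> fst p \<noteq> snd p
      \<and> inc G (fst p) = inc G (snd p)"

definition single_trans :: "('v,'h) hgraph \<Rightarrow> 'h set \<Rightarrow> bool" where
  "single_trans G s \<longleftrightarrow> (\<exists>a b. s = {a,b} \<and> dsingle_trans G (a,b))"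

definition transition_at :: "('v,'h) hgraph \<Rightarrow> 'v \<Rightarrow> 'h set set \<Rightarrow> bool" where
  "transition_at G v t \<longleftrightarrow> (\<exists>s1 s2. t = {s1,s2} \<and> single_trans G s1 \<and> single_trans G s2
      \<and> s1 \<inter> s2 = {} \<and> s1 \<union> s2 = {h\<in>hes G. inc G h = v})"

text \<open>Closed walks are represented by lists of directed single transitions
  (any representative of the cyclic-shift class).\<close>
definition closed_walk :: "('v,'h) hgraph \<Rightarrow> ('h \<times> 'h) list \<Rightarrow> bool" where
  "closed_walk G ws \<longleftrightarrow> (\<forall>p\<in>set ws. dsingle_trans G p) \<and>
     (\<forall>i<length ws. {snd (ws ! i), fst (ws ! ((i + 1) mod length ws))} \<in> edges G)"

definition trav :: "('h \<times> 'h) list \<Rightarrow> ('h \<times> 'h) list" where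
  "trav ws = map (\<lambda>i. (snd (ws ! i), fst (ws ! ((i + 1) mod length ws)))) [0..<length ws]"

definition sigma_t :: "('h set \<Rightarrow> 'h \<times> 'h) \<Rightarrow> ('h \<times> 'h) list \<Rightarrow> 'h set \<Rightarrow> int" where
  "sigma_t D ts e = int (length (filter (\<lambda>p. p = D e) ts))
                  - int (length (filter (\<lambda>p. p = prod.swap (D e)) ts))"

definition sigma :: "('v,'h) hgraph \<Rightarrow> ('h set \<Rightarrow> 'h \<times> 'h) \<Rightarrow> ('h \<times> 'h) list \<Rightarrow> 'h set \<Rightarrow> int" where
  "sigma G D ws e = (if e \<in> edges G then sigma_t D (trav ws) e else 0)"

definition incidence :: "('v,'h) hgraph \<Rightarrow> ('h set \<Rightarrow> 'h \<times> 'h) \<Rightarrow> 'v \<Rightarrow> 'h set \<Rightarrow> rat" where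
  "incidence G D v e = (if inc G (snd (D e)) = v then 1 else 0) - (if inc G (fst (D e)) = v then 1 else 0)"

definition cycle_space :: "('v,'h) hgraph \<Rightarrow> ('h set \<Rightarrow> 'h \<times> 'h) \<Rightarrow> ('h set \<Rightarrow> rat) set" where
  "cycle_space G D = {x. (\<forall>e. e \<notin> edges G \<longrightarrow> x e = 0) \<and>
      (\<forall>v\<in>verts G. (\<Sum>e\<in>edges G. incidence G D v e * x e) = 0)}"

definition cycle_basis :: "('v,'h) hgraph \<Rightarrow> ('h set \<Rightarrow> 'h \<times> 'h) \<Rightarrow> ('h \<times> 'h) list set \<Rightarrow> bool" where
  "cycle_basis G D B \<longleftrightarrow> finite B \<and> (\<forall>W\<in>B. closed_walk G W)
     \<and> inj_on (sigma G D) B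
     \<and> (\<forall>W\<in>B. (\<lambda>e. of_int (sigma G D W e)) \<in> cycle_space G D)
     \<and> (\<forall>c :: ('h \<times> 'h) list \<Rightarrow> rat.
          (\<lambda>e. \<Sum>W\<in>B. c W * of_int (sigma G D W e)) = (\<lambda>e. 0) \<longrightarrow> (\<forall>W\<in>B. c W = 0))
     \<and> (\<forall>x\<in>cycle_space G D. \<exists>c :: ('h \<times> 'h) list \<Rightarrow> rat.
          x = (\<lambda>e. \<Sum>W\<in>B. c W * of_int (sigma G D W e)))"

definition integral_cycle_basis :: "('v,'h) hgraph \<Rightarrow> ('h set \<Rightarrow> 'h \<times> 'h) \<Rightarrow> ('h \<times> 'h) list set \<Rightarrow> bool" where
  "integral_cycle_basis G D B \<longleftrightarrow> cycle_basis G D B \<and>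
     (\<forall>W. closed_walk G W \<longrightarrow> (\<exists>c :: ('h \<times> 'h) list \<Rightarrow> int.
          sigma G D W = (\<lambda>e. \<Sum>W'\<in>B. c W' * sigma G D W' e)))"

definition circuit_walk :: "('v,'h) hgraph \<Rightarrow> ('h \<times> 'h) list \<Rightarrow> bool" where
  "circuit_walk G ws \<longleftrightarrow> closed_walk G ws \<and> ws \<noteq> [] \<and> distinct (concat (map (\<lambda>p. [fst p, snd p]) ws))"

definition walk_class :: "('h \<times> 'h) list \<Rightarrow> ('h \<times> 'h) list set" where
  "walk_class ws = {rotate k ws | k. True} \<union> {rotate k (rev (map prod.swap ws)) | k. True}"

definition is_circuit :: "('v,'h) hgraph \<Rightarrow> ('h \<times> 'h) list set \<Rightarrow> bool" where
  "is_circuit G C \<longleftrightarrow> (\<exists>ws. circuit_walk G ws \<and> C = walk_class ws)"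

definition st_of :: "('h \<times> 'h) list set \<Rightarrow> 'h set set" where
  "st_of C = {{a,b} | a b. \<exists>ws\<in>C. (a,b) \<in> set ws}"

definition circuit_partition :: "('v,'h) hgraph \<Rightarrow> ('h \<times> 'h) list set set \<Rightarrow> bool" where
  "circuit_partition G P \<longleftrightarrow> (\<forall>C\<in>P. is_circuit G C) \<and>
     (\<forall>h\<in>hes G. \<exists>!Cs. fst Cs \<in> P \<and> snd Cs \<in> st_of (fst Cs) \<and> h \<in> snd Cs)"

definition tau :: "('v,'h) hgraph \<Rightarrow> ('h \<times> 'h) list set set \<Rightarrow> 'h set set set" where
  "tau G P = {t. (\<exists>v. transition_at G v t) \<and> (\<forall>s\<in>t. \<exists>C\<in>P. s \<in> st_of C)}"

definition touch_graph :: "('v,'h) hgraph \<Rightarrow> ('h \<times> 'h) list set set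
                           \<Rightarrow> (('h \<times> 'h) list set, 'h set) hgraph" where
  "touch_graph G P = \<lparr> verts = P, hes = \<Union>(st_of ` P), edges = tau G P,
                       inc = (\<lambda>s. THE C. C \<in> P \<and> s \<in> st_of C) \<rparr>"

definition st_containing :: "('h \<times> 'h) list set set \<Rightarrow> 'h \<Rightarrow> 'h set" where
  "st_containing P h = (THE s. s \<in> \<Union>(st_of ` P) \<and> h \<in> s)"

text \<open>\<pi>_P(W): the list of edge traversals (s,s') of the touch-graph.\<close>
definition pi_P :: "('h \<times> 'h) list set set \<Rightarrow> ('h \<times> 'h) list \<Rightarrow> ('h set \<times> 'h set) list" where
  "pi_P P ws = filter (\<lambda>p. fst p \<noteq> snd p)
                 (map (\<lambda>p. (st_containing P (fst p), st_containing P (snd p))) ws)"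

definition sigma_pi :: "('h \<times> 'h) list set set \<Rightarrow> ('h set set \<Rightarrow> 'h set \<times> 'h set)
                        \<Rightarrow> ('h \<times> 'h) list \<Rightarrow> 'h set set \<Rightarrow> int" where
  "sigma_pi P D ws t = sigma_t D (pi_P P ws) t"

end

(* Cutting every vertex of F along its transition in P turns F into the disjoint union of the
   circuits of P, and the entry of the matrix at a vertex is the net flow of the walk into one of
   the two halves.  If some circuit of P avoids E, it is a nonzero cycle of F - E with zero image,
   so the rows are dependent.  Otherwise every circuit contains an edge of E, where the flow
   vanishes; a rational cycle with integral image then has integral values, by propagation along
   the circuits.  Integral cycles are integral combinations of the basis, so a nonsingular matrix
   has an integral inverse.  The matrix is square because an even graph has no bridge, so F - E has
   as many components as F and its cycle space has dimension |E(F)| - |V(F)| = |V(F)|. *)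

theory Submission
  imports Defs
begin

text \<open>Edge vectors depend on a choice of direction and make loops a special case. Recording
  the flow into the vertex through each half-edge removes both: the two halves of an edge, loop or
  not, carry opposite values, and the conservation law becomes a sum over the half-edges at a
  vertex. A single transition of \<open>P\<close> is half of such a sum, so up to sign the flow into
  it is a combination of the entries in one column of the matrix.

  Integrality of the basis is given for closed walks only, whereas the inverse matrix produces
  integral cycles; these must be decomposed into closed walks before the assumption applies.

  As \<open>E\<close> has one edge per component, all circuits can meet \<open>E\<close> only if
  each component carries exactly one circuit. This is the only situation in which the determinant
  can be nonzero.\<close>

subsection \<open>Flows through half-edges\<close>

text \<open>Net flow into the vertex of a half-edge through that half-edge: \<open>hflow\<close> for an edge vector,
  \<open>wflow\<close> for a walk (arrivals minus departures).\<close>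
definition hflow :: "'h set set \<Rightarrow> ('h set \<Rightarrow> 'h \<times> 'h) \<Rightarrow> ('h set \<Rightarrow> 'a::comm_ring_1) \<Rightarrow> 'h \<Rightarrow> 'a" where
  "hflow Es D x h = (\<Sum>e\<in>Es. x e * (of_bool (snd (D e) = h) - of_bool (fst (D e) = h)))"

definition wflow :: "('h \<times> 'h) list \<Rightarrow> 'h \<Rightarrow> int" where
  "wflow W h = (\<Sum>p\<leftarrow>W. of_bool (fst p = h) - of_bool (snd p = h))"

section \<open>Half-edges, edges and deletion of edges\<close>

lemma wf_graphD:
  assumes "wf_graph G"
  shows "finite (verts G)" "finite (hes G)" "\<Union>(edges G) = hes G" "inc G ` hes G \<subseteq> verts G"
    "\<And>e. e \<in> edges G \<Longrightarrow> \<exists>a b. a \<noteq> b \<and> e = {a, b}"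
    "\<And>e e'. e \<in> edges G \<Longrightarrow> e' \<in> edges G \<Longrightarrow> e \<noteq> e' \<Longrightarrow> e \<inter> e' = {}"
  using assms unfolding wf_graph_def by simp_all

lemma wf_graph_finite_edges:
  assumes "wf_graph G"
  shows "finite (edges G)"
proof -
  have "edges G \<subseteq> Pow (hes G)" using wf_graphD(3)[OF assms] by auto
  thus ?thesis using wf_graphD(2)[OF assms] by (meson finite_Pow_iff finite_subset)
qed

lemma wf_graph_edge_of:
  assumes "wf_graph G" "h \<in> hes G"
  obtains k where "{h, k} \<in> edges G" "h \<noteq> k"
proof -
  have "h \<in> \<Union>(edges G)" using assms(2) wf_graphD(3)[OF assms(1)] by simp
  then obtain e where e: "e \<in> edges G" "h \<in> e" by (rule UnionE)
  obtain a b where ab: "a \<noteq> b" "e = {a, b}" using wf_graphD(5)[OF assms(1) e(1)] by auto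
  show ?thesis
  proof (cases "h = a")
    case True
    thus ?thesis using that[of b] ab e by simp
  next
    case False
    thus ?thesis using that[of a] ab e by (simp add: insert_commute)
  qed
qed

lemma wf_graph_edge_eq:
  assumes "wf_graph G" "e \<in> edges G" "e' \<in> edges G" "h \<in> e" "h \<in> e'"
  shows "e = e'"
  using wf_graphD(6)[OF assms(1-3)] assms(4,5) by auto

lemma wf_graph_edge_hes:
  assumes "wf_graph G" "e \<in> edges G" "h \<in> e"
  shows "h \<in> hes G"
  using wf_graphD(3)[OF assms(1)] assms(2,3) by auto

lemma wf_graph_edge_neq:
  assumes "wf_graph G" "{a, b} \<in> edges G"
  shows "a \<noteq> b"
  using wf_graphD(5)[OF assms] by (auto simp: doubleton_eq_iff)

lemma wf_graph_inc:
  assumes "wf_graph G" "h \<in> hes G"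
  shows "inc G h \<in> verts G"
  using wf_graphD(4)[OF assms(1)] assms(2) by auto

lemma wf_graph_del_edges:
  assumes wf: "wf_graph G"
  shows "wf_graph (del_edges G E)"
proof -
  have "\<Union>(edges G - E) = hes G - \<Union>(E \<inter> edges G)"
    unfolding wf_graphD(3)[OF wf, symmetric] using wf_graphD(6)[OF wf]
    by (auto simp: disjoint_iff)
  thus ?thesis using wf_graphD[OF wf] unfolding wf_graph_def del_edges_def by auto
qed

lemma hes_del_edges_iff:
  assumes "wf_graph G" "e \<in> edges G" "h \<in> e"
  shows "h \<in> hes (del_edges G E) \<longleftrightarrow> e \<notin> E"
  using assms wf_graph_edge_eq[OF assms(1)] wf_graph_edge_hes[OF assms(1)]
  unfolding del_edges_def by auto

lemma directed_version_mem:
  assumes "directed_version G D" "e \<in> edges G"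
  shows "fst (D e) \<in> e" "snd (D e) \<in> e" "e = {fst (D e), snd (D e)}"
  using assms unfolding directed_version_def by auto

section \<open>Half-edge flows of edge vectors\<close>

lemma hflow_single:
  assumes wf: "wf_graph G" and D: "directed_version G D" and e: "e \<in> edges G" and h: "h \<in> e"
  shows "hflow (edges G) D x h = x e * (of_bool (snd (D e) = h) - of_bool (fst (D e) = h))"
proof -
  have "hflow (edges G) D x h = (\<Sum>e'\<in>edges G. if e' = e then
          x e * (of_bool (snd (D e) = h) - of_bool (fst (D e) = h)) else 0)"
    unfolding hflow_def
  proof (intro sum.cong refl)
    fix e' assume e': "e' \<in> edges G"
    show "x e' * (of_bool (snd (D e') = h) - of_bool (fst (D e') = h)) =
      (if e' = e then x e * (of_bool (snd (D e) = h) - of_bool (fst (D e) = h)) else 0)"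
      using wf_graph_edge_eq[OF wf e e' h] directed_version_mem(1,2)[OF D e'] by auto
  qed
  thus ?thesis using e wf_graph_finite_edges[OF wf] by simp
qed

lemma directed_version_fst_neq_snd:
  assumes "wf_graph G" "directed_version G D" "e \<in> edges G"
  shows "fst (D e) \<noteq> snd (D e)"
proof -
  have "{fst (D e), snd (D e)} \<in> edges G"
    using directed_version_mem(3)[OF assms(2,3)] assms(3) by argo
  thus ?thesis by (rule wf_graph_edge_neq[OF assms(1)])
qed

lemma hflow_head:
  assumes "wf_graph G" "directed_version G D" "e \<in> edges G"
  shows "hflow (edges G) D x (snd (D e)) = x e"
  using hflow_single[OF assms directed_version_mem(2)[OF assms(2,3)]]
    directed_version_fst_neq_snd[OF assms] by simp

lemma hflow_tail:
  assumes "wf_graph G" "directed_version G D" "e \<in> edges G"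
  shows "hflow (edges G) D x (fst (D e)) = - x e"
  using hflow_single[OF assms directed_version_mem(1)[OF assms(2,3)]]
    directed_version_fst_neq_snd[OF assms] by simp

lemma hflow_edge:
  assumes "wf_graph G" "directed_version G D" "{a, b} \<in> edges G"
  shows "hflow (edges G) D x b = - hflow (edges G) D x a"
proof -
  have "{a, b} = {fst (D {a,b}), snd (D {a,b})}" by (rule directed_version_mem(3)[OF assms(2,3)])
  hence "(a = fst (D {a,b}) \<and> b = snd (D {a,b})) \<or> (b = fst (D {a,b}) \<and> a = snd (D {a,b}))"
    by (auto simp: doubleton_eq_iff)
  thus ?thesis using hflow_head[OF assms, of x] hflow_tail[OF assms, of x] by (elim disjE) simp_all
qed

lemma hflow_outside:
  assumes "wf_graph G" "directed_version G D" "h \<notin> hes G"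
  shows "hflow (edges G) D x h = 0"
  unfolding hflow_def
proof (rule sum.neutral, rule ballI)
  fix e assume e: "e \<in> edges G"
  show "x e * (of_bool (snd (D e) = h) - of_bool (fst (D e) = h)) = 0"
    using directed_version_mem(1,2)[OF assms(2) e] wf_graph_edge_hes[OF assms(1) e] assms(3) by auto
qed

lemma hflow_of_int: "hflow Es D (\<lambda>e. of_int (x e)) h = of_int (hflow Es D x h)"
  unfolding hflow_def by simp

lemma hflow_sum:
  "hflow Es D (\<lambda>e. \<Sum>i\<in>I. c i * s i e) h = (\<Sum>i\<in>I. c i * hflow Es D (s i) h)"
  unfolding hflow_def sum_distrib_left sum_distrib_right
  by (subst sum.swap) (simp add: mult.assoc)

text \<open>An incidence entry is the sum of the signs of the edge at those of its half-edges that
  lie at \<open>v\<close>; for a loop the two signs cancel. Hence the null space of the incidence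
  matrix consists of the conserved half-edge flows.\<close>

lemma incidence_sum_eq_hflow_sum:
  assumes wf: "wf_graph G" and D: "directed_version G D"
  shows "(\<Sum>e\<in>edges G. incidence G D v e * x e)
       = (\<Sum>h | h \<in> hes G \<and> inc G h = v. hflow (edges G) D x h)"
proof -
  have fin: "finite {h. h \<in> hes G \<and> inc G h = v}" using wf_graphD(2)[OF wf] by simp
  have "(\<Sum>h | h \<in> hes G \<and> inc G h = v. of_bool (snd (D e) = h) - of_bool (fst (D e) = h))
      = incidence G D v e" if e: "e \<in> edges G" for e
    using directed_version_mem(1,2)[OF D e] wf_graph_edge_hes[OF wf e] fin
    by (simp add: sum_subtractf incidence_def of_bool_def)
  thus ?thesis unfolding hflow_def
    by (subst sum.swap) (simp flip: sum_distrib_left add: mult.commute)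
qed

lemma cycle_space_iff_hflow:
  assumes "wf_graph G" "directed_version G D"
  shows "x \<in> cycle_space G D \<longleftrightarrow> (\<forall>e. e \<notin> edges G \<longrightarrow> x e = 0) \<and>
    (\<forall>v\<in>verts G. (\<Sum>h | h \<in> hes G \<and> inc G h = v. hflow (edges G) D x h) = 0)"
  unfolding cycle_space_def using incidence_sum_eq_hflow_sum[OF assms] by auto

section \<open>Half-edge flows of walks\<close>

lemma sum_wflow:
  assumes "finite A"
  shows "(\<Sum>h\<in>A. wflow W h) = (\<Sum>p\<leftarrow>W. of_bool (fst p \<in> A) - of_bool (snd p \<in> A))"
proof (induction W)
  case Nil
  show ?case by (simp add: wflow_def)
next
  case (Cons p W)
  have "(\<Sum>h\<in>A. wflow (p # W) h)
      = (\<Sum>h\<in>A. of_bool (fst p = h) - of_bool (snd p = h)) + (\<Sum>h\<in>A. wflow W h)"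
    by (simp add: wflow_def sum.distrib)
  moreover have "(\<Sum>h\<in>A. of_bool (fst p = h) - of_bool (snd p = h) :: int)
      = of_bool (fst p \<in> A) - of_bool (snd p \<in> A)"
    using assms by (simp add: sum_subtractf of_bool_def)
  ultimately show ?case using Cons by simp
qed

lemma length_filter_eq_sum_list:
  "int (length (filter Q xs)) = (\<Sum>x\<leftarrow>xs. of_bool (Q x))"
  by (induction xs) auto

lemma map_fst_trav: "map fst (trav W) = map snd W"
  unfolding trav_def by (auto intro!: nth_equalityI)

text \<open>The traversal following a transition ends at the entry of the cyclically next one,
  whence the rotation. Sums over the walk do not see it, so arrivals can be counted transition by
  transition.\<close>

lemma map_snd_trav: "map snd (trav W) = rotate1 (map fst W)"
proof (rule nth_equalityI)
  fix i assume "i < length (map snd (trav W))"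
  hence i: "i < length W" by (simp add: trav_def)
  hence "Suc i mod length W < length W" by (intro mod_less_divisor) auto
  thus "map snd (trav W) ! i = rotate1 (map fst W) ! i" using i by (simp add: trav_def nth_rotate1)
qed (simp add: trav_def)

lemma sum_list_trav_fst: "(\<Sum>p\<leftarrow>trav W. f (fst p)) = (\<Sum>p\<leftarrow>W. (f (snd p) :: int))"
proof -
  have "(\<Sum>p\<leftarrow>trav W. f (fst p)) = sum_list (map f (map fst (trav W)))" by (simp add: comp_def)
  thus ?thesis unfolding map_fst_trav by (simp add: comp_def)
qed

lemma sum_list_trav_snd: "(\<Sum>p\<leftarrow>trav W. f (snd p)) = (\<Sum>p\<leftarrow>W. (f (fst p) :: int))"
proof -
  have "(\<Sum>p\<leftarrow>trav W. f (snd p)) = sum_list (map f (map snd (trav W)))" by (simp add: comp_def)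
  also have "\<dots> = sum_list (rotate1 (map f (map fst W)))" by (simp only: map_snd_trav rotate1_map)
  also have "\<dots> = sum_list (map f (map fst W))"
    by (cases W) (simp_all add: add.commute)
  finally show ?thesis by (simp add: comp_def)
qed

lemma trav_edge:
  assumes "closed_walk G W" "p \<in> set (trav W)"
  shows "{fst p, snd p} \<in> edges G"
  using assms unfolding closed_walk_def trav_def by auto

text \<open>Reversing the direction of an edge changes the sign of both factors, so \<open>D\<close>
  drops out: a traversal counts 1 at the half-edge where it arrives and -1 at the one where it
  departs. In a transition \<open>(h, h')\<close> of a walk, \<open>h\<close> is the arrival and
  \<open>h'\<close> the departure.\<close>

lemma hflow_sigma:
  assumes wf: "wf_graph G" and D: "directed_version G D" and W: "closed_walk G W"
  shows "hflow (edges G) D (sigma G D W) h = wflow W h"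
proof (cases "h \<in> hes G")
  case False
  have "\<forall>p\<in>set W. fst p \<noteq> h \<and> snd p \<noteq> h"
    using W False unfolding closed_walk_def dsingle_trans_def by auto
  hence "wflow W h = 0" unfolding wflow_def by (induction W) auto
  thus ?thesis using hflow_outside[OF wf D False] by simp
next
  case True
  obtain e where e: "e \<in> edges G" "h \<in> e"
    using wf_graph_edge_of[OF wf True] by (metis insertI1)
  let ?c = "of_bool (snd (D e) = h) - of_bool (fst (D e) = h) :: int"
  obtain a b where ab: "D e = (a, b)" by fastforce
  have ne: "a \<noteq> b" using directed_version_fst_neq_snd[OF wf D e(1)] ab by simp
  have eq: "e = {a, b}" using directed_version_mem(3)[OF D e(1), unfolded ab] by simp
  have h: "h = a \<or> h = b" using eq e(2) by blast
  have "hflow (edges G) D (sigma G D W) h = (\<Sum>p\<leftarrow>trav W.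
      (of_bool (p = D e) - of_bool (p = prod.swap (D e))) * ?c)"
    using hflow_single[OF wf D e, of "sigma G D W"] e
    by (simp add: sigma_def sigma_t_def length_filter_eq_sum_list sum_list_subtractf
        sum_list_mult_const)
  also have "\<dots> = (\<Sum>p\<leftarrow>trav W. of_bool (snd p = h) - of_bool (fst p = h))"
  proof (intro arg_cong[where f = sum_list] map_cong refl)
    fix p assume p: "p \<in> set (trav W)"
    have pe: "{fst p, snd p} \<in> edges G" by (rule trav_edge[OF W p])
    show "(of_bool (p = D e) - of_bool (p = prod.swap (D e))) * ?c
        = of_bool (snd p = h) - of_bool (fst p = h)"
    proof (cases "fst p = h \<or> snd p = h")
      case True
      hence "{fst p, snd p} = e" using wf_graph_edge_eq[OF wf pe e(1)] e(2) by auto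
      hence "(fst p = a \<and> snd p = b) \<or> (fst p = b \<and> snd p = a)"
        unfolding eq doubleton_eq_iff .
      hence "p = (a, b) \<or> p = (b, a)" by (auto simp: prod_eq_iff)
      thus ?thesis unfolding ab using ne h by (elim disjE) simp_all
    next
      case False
      hence "p \<noteq> D e" "p \<noteq> prod.swap (D e)" unfolding ab using h by auto
      thus ?thesis using False by simp
    qed
  qed
  also have "\<dots> = (\<Sum>p\<leftarrow>W. of_bool (fst p = h)) - (\<Sum>p\<leftarrow>W. of_bool (snd p = h))"
    using sum_list_trav_fst[of "\<lambda>k. of_bool (k = h)" W] sum_list_trav_snd[of "\<lambda>k. of_bool (k = h)" W]
    by (simp add: sum_list_subtractf)
  also have "\<dots> = wflow W h" by (simp add: wflow_def sum_list_subtractf)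
  finally show ?thesis .
qed

text \<open>A transition enters and leaves at the same vertex. Stated for lists of transitions, so
  that walks of \<open>del_edges G E\<close> can also be summed over all half-edges of
  \<open>G\<close> at a vertex.\<close>

lemma sum_wflow_vertex:
  assumes wf: "wf_graph G" and W: "\<And>p. p \<in> set W \<Longrightarrow> dsingle_trans G p"
  shows "(\<Sum>h | h \<in> hes G \<and> inc G h = v. wflow W h) = 0"
proof -
  have "finite {h. h \<in> hes G \<and> inc G h = v}" using wf_graphD(2)[OF wf] by simp
  hence "(\<Sum>h | h \<in> hes G \<and> inc G h = v. wflow W h) = (\<Sum>p\<leftarrow>W.
      of_bool (fst p \<in> {h. h \<in> hes G \<and> inc G h = v})
      - of_bool (snd p \<in> {h. h \<in> hes G \<and> inc G h = v}))"
    by (rule sum_wflow)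
  also have "\<dots> = (\<Sum>p\<leftarrow>W. 0)"
    using W unfolding dsingle_trans_def
    by (intro arg_cong[where f = sum_list] map_cong refl) simp
  finally show ?thesis by simp
qed

lemma sigma_in_cycle_space:
  assumes wf: "wf_graph G" and D: "directed_version G D" and W: "closed_walk G W"
  shows "(\<lambda>e. of_int (sigma G D W e)) \<in> cycle_space G D"
proof -
  have "(\<Sum>h | h \<in> hes G \<and> inc G h = v. wflow W h) = 0" for v
    using W unfolding closed_walk_def by (intro sum_wflow_vertex[OF wf]) blast
  thus ?thesis
    unfolding cycle_space_iff_hflow[OF wf D] hflow_of_int hflow_sigma[OF assms]
    by (simp flip: of_int_sum add: sigma_def)
qed

subsection \<open>Integral circulations\<close>

definition circulation :: "('v,'h) hgraph \<Rightarrow> ('h set \<Rightarrow> 'h \<times> 'h) \<Rightarrow> ('h set \<Rightarrow> int) \<Rightarrow> bool" where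
  "circulation G D x \<longleftrightarrow> (\<forall>e. e \<notin> edges G \<longrightarrow> x e = 0) \<and>
    (\<forall>v\<in>verts G. (\<Sum>h | h \<in> hes G \<and> inc G h = v. hflow (edges G) D x h) = 0)"

lemma circulation_iff_cycle_space:
  assumes "wf_graph G" "directed_version G D"
  shows "circulation G D x \<longleftrightarrow> (\<lambda>e. of_int (x e)) \<in> cycle_space G D"
  unfolding circulation_def cycle_space_iff_hflow[OF assms] hflow_of_int
  by (simp flip: of_int_sum)

text \<open>Choose \<open>k\<close> minimal among the periods of all points of \<open>X\<close>: a
  repetition within the first \<open>k\<close> iterates would yield a point of smaller period.
  Injectivity will keep the walk built from the orbit from arriving twice through the same
  half-edge.\<close>

lemma finite_self_map_periodic_point:
  assumes "finite X" "y \<in> X" "N ` X \<subseteq> X"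
  obtains z k where "z \<in> X" "k > 0" "(N ^^ k) z = z" "inj_on (\<lambda>i. (N ^^ i) z) {..<k}"
proof -
  have inX: "(N ^^ i) z \<in> X" if "z \<in> X" for i z
    using that assms(3) by (induction i) auto
  define Q where "Q k \<longleftrightarrow> k > 0 \<and> (\<exists>z\<in>X. (N ^^ k) z = z)" for k
  have shift: "Q (j - i)" if "i < j" "(N ^^ i) z = (N ^^ j) z" "z \<in> X" for i j z
  proof -
    have "(N ^^ (j - i)) ((N ^^ i) z) = (N ^^ (j - i + i)) z" by (simp add: funpow_add)
    also have "\<dots> = (N ^^ i) z" using that by simp
    finally show ?thesis using that inX[of z i] unfolding Q_def by auto
  qed
  have "\<not> inj_on (\<lambda>i. (N ^^ i) y) (UNIV :: nat set)"
  proof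
    assume "inj_on (\<lambda>i. (N ^^ i) y) (UNIV :: nat set)"
    hence "finite (UNIV :: nat set)"
      by (rule inj_on_finite[where B = X]) (use assms inX in auto)
    thus False by simp
  qed
  then obtain i j where "(N ^^ i) y = (N ^^ j) y" "i \<noteq> j" unfolding inj_on_def by auto
  hence "\<exists>k. Q k" using shift[of i j y] shift[of j i y] assms(2) by (metis nat_neq_iff)
  hence Q: "Q (LEAST k. Q k)" by (rule LeastI_ex)
  then obtain z where z: "z \<in> X" "(N ^^ (LEAST k. Q k)) z = z" "(LEAST k. Q k) > 0"
    unfolding Q_def by auto
  have "inj_on (\<lambda>i. (N ^^ i) z) {..<LEAST k. Q k}"
  proof (rule linorder_inj_onI)
    fix i j assume ij: "i < j" "i \<in> {..<LEAST k. Q k}" "j \<in> {..<LEAST k. Q k}"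
    show "(N ^^ i) z \<noteq> (N ^^ j) z"
    proof
      assume "(N ^^ i) z = (N ^^ j) z"
      hence "Q (j - i)" using shift ij z by simp
      hence "(LEAST k. Q k) \<le> j - i" by (rule Least_le)
      thus False using ij by auto
    qed
  qed auto
  thus ?thesis using that z by blast
qed

lemma sum_list_of_bool_distinct:
  assumes "distinct xs"
  shows "(\<Sum>x\<leftarrow>xs. of_bool (x = a)) = (of_bool (a \<in> set xs) :: int)"
  using assms by (induction xs) auto

text \<open>Follow the flow. At a vertex where positive flow arrives, conservation provides a
  half-edge with negative flow, and the other half of its edge again receives positive flow. This is
  a self-map of a finite set; a periodic orbit is a closed walk that runs with the flow and uses no
  arrival twice. As \<open>x\<close> is integral, subtracting the walk moves its values towards 0
  without overshooting.\<close>

lemma circulation_conformal_walk: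
  fixes x :: "'h set \<Rightarrow> int"
  assumes wf: "wf_graph G" and D: "directed_version G D" and x: "circulation G D x"
    and nz: "x \<noteq> (\<lambda>e. 0)"
  obtains W e where "closed_walk G W" "\<And>e. \<bar>x e - sigma G D W e\<bar> \<le> \<bar>x e\<bar>"
    "e \<in> edges G" "\<bar>x e - sigma G D W e\<bar> < \<bar>x e\<bar>"
proof -
  let ?f = "hflow (edges G) D x"
  define X where "X = {h \<in> hes G. ?f h > 0}"
  have finX: "finite X" unfolding X_def using wf_graphD(2)[OF wf] by simp
  have "\<exists>k l. k \<in> hes G \<and> inc G k = inc G h \<and> ?f k < 0 \<and> {k, l} \<in> edges G \<and> l \<in> X" if h: "h \<in> X" for h
  proof -
    have hh: "h \<in> hes G" "?f h > 0" using h unfolding X_def by auto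
    let ?A = "{k. k \<in> hes G \<and> inc G k = inc G h}"
    have fin: "finite ?A" using wf_graphD(2)[OF wf] by simp
    have "(\<Sum>k\<in>?A. ?f k) = 0"
      using x wf_graph_inc[OF wf hh(1)] unfolding circulation_def by blast
    hence "\<exists>k\<in>?A. ?f k < 0"
      using sum_pos2[OF fin, of h ?f] hh by force
    then obtain k where k: "k \<in> hes G" "inc G k = inc G h" "?f k < 0" by auto
    obtain l where l: "{k, l} \<in> edges G" using wf_graph_edge_of[OF wf k(1)] .
    hence "l \<in> X" using k wf_graph_edge_hes[OF wf l, of l] hflow_edge[OF wf D l, of x]
      unfolding X_def by simp
    thus ?thesis using k l by blast
  qed
  then obtain out N where N: "\<And>h. h \<in> X \<Longrightarrow> out h \<in> hes G \<and> inc G (out h) = inc G h \<and> ?f (out h) < 0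
      \<and> {out h, N h} \<in> edges G \<and> N h \<in> X" by metis
  have "X \<noteq> {}"
  proof -
    obtain e where e: "x e \<noteq> 0" using nz by auto
    hence eG: "e \<in> edges G" using x unfolding circulation_def by auto
    have "snd (D e) \<in> X \<or> fst (D e) \<in> X"
      using hflow_head[OF wf D eG, of x] hflow_tail[OF wf D eG, of x] e
        wf_graph_edge_hes[OF wf eG directed_version_mem(1)[OF D eG]]
        wf_graph_edge_hes[OF wf eG directed_version_mem(2)[OF D eG]]
      unfolding X_def by simp linarith
    thus ?thesis by auto
  qed
  then obtain y where "y \<in> X" by auto
  moreover have "N ` X \<subseteq> X" using N by auto
  ultimately obtain z k where z: "z \<in> X" "k > 0" "(N ^^ k) z = z" "inj_on (\<lambda>i. (N ^^ i) z) {..<k}"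
    by (rule finite_self_map_periodic_point[OF finX])
  have inX: "(N ^^ i) z \<in> X" for i
    using z(1) N by (induction i) auto
  define W where "W = map (\<lambda>i. ((N ^^ i) z, out ((N ^^ i) z))) [0..<k]"
  have W_fst: "fst p \<in> X" "?f (snd p) < 0" if "p \<in> set W" for p
    using that inX N unfolding W_def by auto
  have cw: "closed_walk G W"
    unfolding closed_walk_def
  proof (intro conjI ballI allI impI)
    fix p assume "p \<in> set W"
    then obtain h where h: "h \<in> X" "p = (h, out h)" unfolding W_def using inX by auto
    have "h \<noteq> out h" using N[OF h(1)] h(1) unfolding X_def by fastforce
    thus "dsingle_trans G p" using N[OF h(1)] h unfolding dsingle_trans_def X_def by simp
  next
    fix i assume "i < length W"
    hence i: "i < k" unfolding W_def by simp
    have "(N ^^ ((i + 1) mod k)) z = N ((N ^^ i) z)"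
    proof (cases "i + 1 = k")
      case True
      thus ?thesis using z(3) by (metis comp_apply funpow_0 funpow.simps(2) mod_self Suc_eq_plus1)
    next
      case False
      thus ?thesis using i by simp
    qed
    moreover have "(i + 1) mod k < k" using z(2) by simp
    ultimately have "fst (W ! ((i + 1) mod length W)) = N ((N ^^ i) z)"
      unfolding W_def by simp
    moreover have "snd (W ! i) = out ((N ^^ i) z)" using i unfolding W_def by simp
    ultimately show "{snd (W ! i), fst (W ! ((i + 1) mod length W))} \<in> edges G"
      using N[OF inX[of i]] by simp
  qed
  have dist: "distinct (map fst W)"
    unfolding W_def using z(4) by (simp add: distinct_map comp_def atLeast0LessThan)
  have wfl: "wflow W h = of_bool (h \<in> set (map fst W)) - (\<Sum>p\<leftarrow>W. of_bool (snd p = h))" for h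
    using sum_list_of_bool_distinct[OF dist, of h]
    by (simp add: wflow_def sum_list_subtractf comp_def)
  \<comment> \<open>Departures occur only where the flow is negative, so elsewhere
    \<open>wflow\<close> counts arrivals alone, each at most once.\<close>
  have nosnd: "(\<Sum>p\<leftarrow>W. of_bool (snd p = h)) = (0::int)" if "?f h \<ge> 0" for h
  proof -
    have "(\<Sum>p\<leftarrow>W. of_bool (snd p = h)) = (\<Sum>p\<leftarrow>W. (0::int))"
      using W_fst(2) that by (intro arg_cong[where f = sum_list] map_cong refl) force
    thus ?thesis by simp
  qed
  have pos: "wflow W h = of_bool (h \<in> set (map fst W))" if "?f h \<ge> 0" for h
    using wfl[of h] nosnd[OF that] by simp
  have zero: "wflow W h = 0" if "?f h = 0" for h
  proof -
    have "h \<notin> set (map fst W)" using W_fst(1) that unfolding X_def by fastforce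
    thus ?thesis using pos[of h] that by simp
  qed
  have bd: "(0 < x e \<longrightarrow> sigma G D W e = of_bool (snd (D e) \<in> set (map fst W))) \<and>
      (x e < 0 \<longrightarrow> sigma G D W e = - of_bool (fst (D e) \<in> set (map fst W))) \<and>
      (x e = 0 \<longrightarrow> sigma G D W e = 0)" for e
  proof (cases "e \<in> edges G")
    case False
    thus ?thesis using x unfolding circulation_def sigma_def by auto
  next
    case True
    note H = hflow_head[OF wf D True, of x] hflow_tail[OF wf D True, of x]
      hflow_head[OF wf D True, of "sigma G D W"] hflow_tail[OF wf D True, of "sigma G D W"]
      hflow_sigma[OF wf D cw, of "snd (D e)"] hflow_sigma[OF wf D cw, of "fst (D e)"]
    show ?thesis
    proof (intro conjI impI)
      assume "0 < x e"
      thus "sigma G D W e = of_bool (snd (D e) \<in> set (map fst W))" using H pos[of "snd (D e)"] by linarith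
    next
      assume "x e < 0"
      thus "sigma G D W e = - of_bool (fst (D e) \<in> set (map fst W))" using H pos[of "fst (D e)"] by linarith
    next
      assume "x e = 0"
      thus "sigma G D W e = 0" using H zero[of "snd (D e)"] by linarith
    qed
  qed
  have le: "\<bar>x e - sigma G D W e\<bar> \<le> \<bar>x e\<bar>" for e
    using bd[of e] by (cases "x e" "0::int" rule: linorder_cases) (auto simp: of_bool_def)
  have "z \<in> set (map fst W)" unfolding W_def using z(2) by force
  obtain l where l: "{z, l} \<in> edges G" "z \<noteq> l"
    using wf_graph_edge_of[OF wf, of z] z(1) unfolding X_def by auto
  \<comment> \<open>The walk arrives through \<open>z\<close>, so on the edge containing
    \<open>z\<close> the absolute value drops strictly.\<close>
  define e where "e = {z, l}"
  have eG: "e \<in> edges G" unfolding e_def by (rule l)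
  have ze: "z = snd (D e) \<or> z = fst (D e)"
    using directed_version_mem(3)[OF D eG] unfolding e_def by blast
  have "?f z > 0" using z(1) unfolding X_def by simp
  hence "\<bar>x e - sigma G D W e\<bar> < \<bar>x e\<bar>"
    using ze bd[of e] \<open>z \<in> set (map fst W)\<close> hflow_head[OF wf D eG, of x] hflow_tail[OF wf D eG, of x]
    by (elim disjE) simp_all
  thus ?thesis using that cw le eG by blast
qed

text \<open>An integral basis is only assumed to generate closed walks. Subtracting conformal closed
  walks lowers the sum of absolute values, and induction on that sum reduces any integral cycle to
  closed walks.\<close>

lemma circulation_in_integral_span:
  fixes x :: "'h set \<Rightarrow> int"
  assumes wf: "wf_graph G" and D: "directed_version G D" and B: "integral_cycle_basis G D B"
    and x: "circulation G D x"
  shows "\<exists>c :: ('h \<times> 'h) list \<Rightarrow> int. x = (\<lambda>e. \<Sum>W\<in>B. c W * sigma G D W e)"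
  using x
proof (induction "nat (\<Sum>e\<in>edges G. \<bar>x e\<bar>)" arbitrary: x rule: less_induct)
  case less
  show ?case
  proof (cases "x = (\<lambda>e. 0)")
    case True
    thus ?thesis by (intro exI[of _ "\<lambda>_. 0"]) simp
  next
    case False
    obtain W e where W: "closed_walk G W" "\<And>e. \<bar>x e - sigma G D W e\<bar> \<le> \<bar>x e\<bar>"
      and e: "e \<in> edges G" "\<bar>x e - sigma G D W e\<bar> < \<bar>x e\<bar>"
      using circulation_conformal_walk[OF wf D less.prems False] by blast
    let ?y = "\<lambda>e. x e - sigma G D W e"
    have "(\<Sum>e\<in>edges G. \<bar>?y e\<bar>) < (\<Sum>e\<in>edges G. \<bar>x e\<bar>)"
      by (rule sum_strict_mono_ex1) (use W(2) e wf_graph_finite_edges[OF wf] in auto)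
    hence lt: "nat (\<Sum>e\<in>edges G. \<bar>?y e\<bar>) < nat (\<Sum>e\<in>edges G. \<bar>x e\<bar>)"
      using sum_nonneg[of "edges G" "\<lambda>e. \<bar>?y e\<bar>"] by linarith
    have "circulation G D (sigma G D W)"
      using sigma_in_cycle_space[OF wf D W(1)] circulation_iff_cycle_space[OF wf D] by auto
    moreover have "hflow (edges G) D ?y h = hflow (edges G) D x h - hflow (edges G) D (sigma G D W) h" for h
      unfolding hflow_def by (simp add: left_diff_distrib sum_subtractf)
    ultimately have "circulation G D ?y"
      using less.prems unfolding circulation_def by (simp add: sum_subtractf)
    from less.hyps[OF lt this] obtain c where c: "?y = (\<lambda>e. \<Sum>W\<in>B. c W * sigma G D W e)" by auto
    obtain d where d: "sigma G D W = (\<lambda>e. \<Sum>W'\<in>B. d W' * sigma G D W' e)"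
      using B W(1) unfolding integral_cycle_basis_def by blast
    have "x = (\<lambda>e. \<Sum>W\<in>B. (c W + d W) * sigma G D W e)"
    proof
      fix e
      have "x e = ?y e + sigma G D W e" by simp
      also have "?y e = (\<Sum>W\<in>B. c W * sigma G D W e)" using c by meson
      also have "sigma G D W e = (\<Sum>W\<in>B. d W * sigma G D W e)" using d by meson
      finally show "x e = (\<Sum>W\<in>B. (c W + d W) * sigma G D W e)"
        by (simp add: distrib_right sum.distrib)
    qed
    thus ?thesis by (rule exI[of _ "\<lambda>W. c W + d W"])
  qed
qed

subsection \<open>Bridgelessness\<close>

lemma adj_sym: "adj G u v \<Longrightarrow> adj G v u"
  unfolding adj_def by (metis insert_commute)

lemma reach_sym:
  assumes "reach G u v"
  shows "reach G v u"
  using assms unfolding reach_def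
  by (induction rule: rtranclp_induct) (auto intro: converse_rtranclp_into_rtranclp adj_sym)

lemma reach_trans: "reach G u v \<Longrightarrow> reach G v w \<Longrightarrow> reach G u w"
  unfolding reach_def by (rule rtranclp_trans)

lemma reach_refl: "reach G u u"
  unfolding reach_def by simp

lemma reach_edge: "{a, b} \<in> edges G \<Longrightarrow> reach G (inc G a) (inc G b)"
  unfolding reach_def adj_def by (rule r_into_rtranclp) blast

lemma reach_verts:
  assumes wf: "wf_graph G" and "reach G u v" "u \<in> verts G"
  shows "v \<in> verts G"
  using assms(2,3) unfolding reach_def
proof (induction rule: rtranclp_induct)
  case (step y z)
  then obtain a b where "{a, b} \<in> edges G" "inc G b = z" unfolding adj_def by auto
  thus ?case using wf_graph_inc[OF wf wf_graph_edge_hes[OF wf, of "{a,b}" b]] by auto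
qed

text \<open>Closure under passing to the other half makes \<open>H\<close> a disjoint union of
  edges, hence of pairs. For all half-edges this counts the edges; for one side of a supposed bridge
  it gives the parity contradiction.\<close>

lemma even_card_union_edges:
  assumes wf: "wf_graph G" and H: "H \<subseteq> hes G" and cl: "\<And>a b. {a, b} \<in> edges G \<Longrightarrow> a \<in> H \<Longrightarrow> b \<in> H"
  shows "card H = 2 * card {e \<in> edges G. e \<subseteq> H}"
proof -
  let ?C = "{e \<in> edges G. e \<subseteq> H}"
  have "\<Union>?C = H"
  proof
    show "H \<subseteq> \<Union>?C"
    proof
      fix h assume h: "h \<in> H"
      hence hG: "h \<in> hes G" using H by blast
      obtain k where k: "{h, k} \<in> edges G" using wf_graph_edge_of[OF wf hG] .
      hence "{h, k} \<in> ?C" using cl[OF k h] h by simp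
      thus "h \<in> \<Union>?C" by blast
    qed
  qed blast
  moreover have "2 * card ?C = card (\<Union>?C)"
  proof (rule card_partition)
    show "finite ?C" using wf_graph_finite_edges[OF wf] by simp
    show "finite (\<Union>?C)" unfolding calculation using H wf_graphD(2)[OF wf] by (rule finite_subset)
    show "card c = 2" if "c \<in> ?C" for c
      using wf_graphD(5)[OF wf, of c] that by auto
    show "c \<inter> d = {}" if "c \<in> ?C" "d \<in> ?C" "c \<noteq> d" for c d
      using wf_graphD(6)[OF wf] that by simp
  qed
  ultimately show ?thesis by simp
qed

lemma card_hes_at_vertices:
  assumes wf: "wf_graph G" and reg: "four_regular G" and K: "K \<subseteq> verts G"
  shows "card {h \<in> hes G. inc G h \<in> K} = 4 * card K"
proof -
  have finK: "finite K" using K wf_graphD(1)[OF wf] by (rule finite_subset)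
  have "{h \<in> hes G. inc G h \<in> K} = (\<Union>v\<in>K. {h \<in> hes G. inc G h = v})" by auto
  moreover have "card \<dots> = (\<Sum>v\<in>K. card {h \<in> hes G. inc G h = v})"
    using finK wf_graphD(2)[OF wf] by (intro card_UN_disjoint) auto
  moreover have "\<dots> = (\<Sum>v\<in>K. 4)"
    using reg K unfolding four_regular_def by (intro sum.cong refl) blast
  ultimately show ?thesis by simp
qed

lemma four_regular_card_edges:
  assumes wf: "wf_graph G" and reg: "four_regular G"
  shows "card (edges G) = 2 * card (verts G)"
proof -
  have "card (hes G) = 2 * card {e \<in> edges G. e \<subseteq> hes G}"
    by (rule even_card_union_edges[OF wf]) (use wf_graph_edge_hes[OF wf] in auto)
  moreover have "{e \<in> edges G. e \<subseteq> hes G} = edges G" using wf_graph_edge_hes[OF wf] by auto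
  moreover have "{h \<in> hes G. inc G h \<in> verts G} = hes G" using wf_graph_inc[OF wf] by auto
  ultimately show ?thesis using card_hes_at_vertices[OF wf reg subset_refl] by simp
qed

lemma based_unique:
  assumes wf: "wf_graph G" and b: "based G E" and "e \<in> E" "e' \<in> E" "h \<in> e" "h' \<in> e'"
    and "reach G (inc G h) (inc G h')"
  shows "e = e'"
proof -
  have "e \<in> edges G" using b assms(3) unfolding based_def by auto
  hence "inc G h \<in> verts G" using wf_graph_inc[OF wf wf_graph_edge_hes[OF wf _ assms(5)]] by simp
  hence "\<exists>!e. e \<in> E \<and> (\<exists>k\<in>e. reach G (inc G h) (inc G k))"
    using b unfolding based_def by simp
  moreover have "\<exists>k\<in>e. reach G (inc G h) (inc G k)" using assms(5) reach_refl by fast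
  moreover have "\<exists>k\<in>e'. reach G (inc G h) (inc G k)" using assms(6,7) by fast
  ultimately show ?thesis using assms(3,4) by (elim ex1E) blast
qed

lemma adj_del_edges:
  assumes "{a, b} \<in> edges G" "{a, b} \<notin> E"
  shows "reach (del_edges G E) (inc G a) (inc G b)"
  using reach_edge[of a b "del_edges G E"] assms by (simp add: del_edges_def)

lemma reach_del_edges_imp_reach:
  assumes "reach (del_edges G E) u v"
  shows "reach G u v"
proof -
  have "adj (del_edges G E) x y \<Longrightarrow> adj G x y" for x y
    unfolding adj_def del_edges_def by auto
  thus ?thesis using assms unfolding reach_def by (metis mono_rtranclp)
qed

text \<open>An even graph has no bridge: otherwise the half-edges on one side of the bridge,
  without the one belonging to the bridge itself, would form an odd number of half-edges
  that is a union of edges.\<close>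
lemma reach_del_based:
  assumes wf: "wf_graph G" and reg: "four_regular G" and b: "based G E" and r: "reach G u v"
  shows "reach (del_edges G E) u v"
proof -
  let ?R = "reach (del_edges G E)"
  have bridge: "?R (inc G a) (inc G b)" if ab: "{a, b} \<in> edges G" "{a, b} \<in> E" for a b
  proof (rule ccontr)
    assume nr: "\<not> ?R (inc G a) (inc G b)"
    define K where "K = {w. ?R (inc G a) w}"
    have aG: "a \<in> hes G" using wf_graph_edge_hes[OF wf ab(1)] by simp
    have K: "K \<subseteq> verts G"
      using reach_verts[OF wf] reach_del_edges_imp_reach wf_graph_inc[OF wf aG]
      unfolding K_def by (metis mem_Collect_eq subsetI)
    let ?H = "{h \<in> hes G. inc G h \<in> K}"
    have aH: "a \<in> ?H" using aG reach_refl unfolding K_def by auto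
    have "card (?H - {a}) = 2 * card {e \<in> edges G. e \<subseteq> ?H - {a}}"
    proof (rule even_card_union_edges[OF wf])
      fix h k assume hk: "{h, k} \<in> edges G" "h \<in> ?H - {a}"
      hence h: "?R (inc G a) (inc G h)" "h \<noteq> a" unfolding K_def by auto
      \<comment> \<open>A based set has one edge in this component, so \<open>{h, k}\<close> would
        be the bridge itself and \<open>h\<close> its far end \<open>b\<close>, which is out of
        reach.\<close>
      have "{h, k} \<notin> E"
      proof
        assume "{h, k} \<in> E"
        hence "{a, b} = {h, k}"
          using based_unique[OF wf b ab(2), of "{h,k}" a h] reach_del_edges_imp_reach[OF h(1)] by simp
        hence "h = b" using h(2) by (auto simp: doubleton_eq_iff)
        thus False using h nr by simp
      qed
      hence "?R (inc G a) (inc G k)" "k \<noteq> a"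
        using reach_trans[OF h(1) adj_del_edges[OF hk(1)]] ab(2) wf_graph_edge_eq[OF wf hk(1) ab(1), of a]
        by auto
      thus "k \<in> ?H - {a}" using wf_graph_edge_hes[OF wf hk(1), of k] unfolding K_def by simp
    qed blast
    moreover have "card ?H = Suc (card (?H - {a}))"
      using aH wf_graphD(2)[OF wf] by (intro card.remove) auto
    ultimately have "4 * card K = Suc (2 * card {e \<in> edges G. e \<subseteq> ?H - {a}})"
      using card_hes_at_vertices[OF wf reg K] by simp
    thus False by presburger
  qed
  show ?thesis using r unfolding reach_def[of G]
  proof (induction rule: rtranclp_induct)
    case base
    show ?case by (rule reach_refl)
  next
    case (step y z)
    then obtain a b where "{a, b} \<in> edges G" "inc G a = y" "inc G b = z" unfolding adj_def by auto
    hence "?R y z" using bridge[of a b] adj_del_edges[of a b G E] by blast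
    thus ?case using step.IH reach_trans by metis
  qed
qed

subsection \<open>Dimension of the cycle space\<close>

lemma incidence_del_edges: "incidence (del_edges G E) D = incidence G D"
  unfolding incidence_def del_edges_def by (intro ext) simp

definition edge_root :: "('v,'h) hgraph \<Rightarrow> 'h set \<Rightarrow> 'v" where
  "edge_root G e = inc G (SOME h. h \<in> e)"

text \<open>The boundary map of \<^term>\<open>del_edges G E\<close>, with one extra column per edge of a based set
  \<^term>\<open>E\<close> so that it becomes surjective without enlarging its kernel.\<close>
definition based_incidence :: "('v,'h) hgraph \<Rightarrow> 'h set set \<Rightarrow> ('h set \<Rightarrow> 'h \<times> 'h) \<Rightarrow> 'v \<Rightarrow> 'h set \<Rightarrow> rat" where
  "based_incidence G E D v e = (if e \<in> E then of_bool (edge_root G e = v) else incidence G D v e)"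

lemma edge_root:
  assumes "wf_graph G" "e \<in> edges G"
  obtains h where "h \<in> e" "edge_root G e = inc G h"
proof -
  have "\<exists>h. h \<in> e" using wf_graphD(5)[OF assms] by auto
  hence "(SOME h. h \<in> e) \<in> e" by (rule someI_ex)
  thus ?thesis using that unfolding edge_root_def by blast
qed

text \<open>The edge of \<open>E\<close> in the component of \<open>v\<close> yields the unit vector
  at its root. By bridgelessness a path of \<open>del_edges G E\<close> leads from the root to
  \<open>v\<close>, and adding plus or minus the unit vector of each path edge moves the image one
  vertex further.\<close>

lemma based_incidence_surj:
  assumes wf: "wf_graph G" and reg: "four_regular G" and b: "based G E"
    and D: "directed_version (del_edges G E) D" and v: "v \<in> verts G"
  shows "\<exists>p. \<forall>u. (\<Sum>e\<in>edges G. based_incidence G E D u e * p e) = of_bool (u = v)"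
proof -
  let ?K = "based_incidence G E D"
  have fin: "finite (edges G)" by (rule wf_graph_finite_edges[OF wf])
  have unit: "(\<Sum>e'\<in>edges G. ?K u e' * (c * of_bool (e' = e))) = c * ?K u e" if "e \<in> edges G" for u e c
    using fin that by (simp add: of_bool_def if_distrib cong: if_cong)
  obtain e h where e: "e \<in> E" "h \<in> e" "reach G v (inc G h)"
    using b v unfolding based_def by blast
  have eG: "e \<in> edges G" using b e(1) unfolding based_def by blast
  obtain k where k: "k \<in> e" "edge_root G e = inc G k" by (rule edge_root[OF wf eG])
  \<comment> \<open>The root was picked by \<open>SOME\<close> and may be the end of
    \<open>e\<close> other than the one reached from \<open>v\<close>.\<close>
  have "reach G (inc G k) (inc G h)"
  proof (cases "k = h")
    case True
    thus ?thesis using reach_refl by metis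
  next
    case False
    hence "e = {k, h}" using wf_graphD(5)[OF wf eG] e(2) k(1) by auto
    thus ?thesis using reach_edge[of k h G] eG by simp
  qed
  hence "reach G (edge_root G e) v" using e(3) k(2) reach_sym reach_trans by metis
  hence "reach (del_edges G E) (edge_root G e) v" by (rule reach_del_based[OF wf reg b])
  thus ?thesis unfolding reach_def
  proof (induction rule: rtranclp_induct)
    case base
    have "(\<Sum>e'\<in>edges G. ?K u e' * of_bool (e' = e)) = of_bool (u = edge_root G e)" for u
      using unit[OF eG, of u 1] e(1) by (simp add: based_incidence_def eq_commute)
    thus ?case by (intro exI[of _ "\<lambda>e'. of_bool (e' = e)"]) blast
  next
    case (step y z)
    then obtain p where p: "\<And>u. (\<Sum>e\<in>edges G. ?K u e * p e) = of_bool (u = y)" by blast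
    obtain a c where ac: "{a, c} \<in> edges G" "{a, c} \<notin> E" "inc G a = y" "inc G c = z"
      using step.hyps(2) unfolding adj_def del_edges_def by auto
    let ?e = "{a, c}"
    have "{a, c} = {fst (D ?e), snd (D ?e)}"
      by (rule directed_version_mem(3)[OF D]) (use ac in \<open>simp add: del_edges_def\<close>)
    hence "(a = fst (D ?e) \<and> c = snd (D ?e)) \<or> (a = snd (D ?e) \<and> c = fst (D ?e))"
      unfolding doubleton_eq_iff .
    \<comment> \<open>The sign with which \<open>D\<close> directs the path edge: 1 from
      \<open>a\<close> to \<open>c\<close>, -1 from \<open>c\<close> to \<open>a\<close>.\<close>
    then obtain s :: rat where s: "\<And>u. s * ?K u ?e = of_bool (u = z) - of_bool (u = y)"
    proof
      assume "a = fst (D ?e) \<and> c = snd (D ?e)"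
      hence "inc G (fst (D ?e)) = y" "inc G (snd (D ?e)) = z" using ac by metis+
      thus thesis using that[of 1] ac(2) by (simp add: based_incidence_def incidence_def eq_commute)
    next
      assume "a = snd (D ?e) \<and> c = fst (D ?e)"
      hence "inc G (fst (D ?e)) = z" "inc G (snd (D ?e)) = y" using ac by metis+
      thus thesis using that[of "-1"] ac(2) by (simp add: based_incidence_def incidence_def eq_commute)
    qed
    have "(\<Sum>e'\<in>edges G. ?K u e' * (p e' + s * of_bool (e' = ?e))) = of_bool (u = z)" for u
    proof -
      have "(\<Sum>e'\<in>edges G. ?K u e' * (p e' + s * of_bool (e' = ?e)))
          = (\<Sum>e'\<in>edges G. ?K u e' * p e') + (\<Sum>e'\<in>edges G. ?K u e' * (s * of_bool (e' = ?e)))"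
        by (simp add: distrib_left sum.distrib)
      also have "\<dots> = of_bool (u = y) + s * ?K u ?e" unfolding p unit[OF ac(1)] ..
      also have "\<dots> = of_bool (u = z)" unfolding s by simp
      finally show ?thesis .
    qed
    thus ?case by (intro exI[of _ "\<lambda>e'. p e' + s * of_bool (e' = ?e)"]) blast
  qed
qed

text \<open>Add the equations over the vertices of one component. Columns outside \<open>E\<close>
  have both ends inside or both outside and contribute 0, and the component contains the root of
  exactly one edge of \<open>E\<close>; so \<open>z\<close> vanishes on that edge. What remains are
  the cycle equations of \<open>del_edges G E\<close>.\<close>

lemma based_incidence_kernel:
  assumes wf: "wf_graph G" and b: "based G E" and D: "directed_version (del_edges G E) D"
    and supp: "\<And>e. e \<notin> edges G \<Longrightarrow> z e = 0"
    and z: "\<And>v. v \<in> verts G \<Longrightarrow> (\<Sum>e\<in>edges G. based_incidence G E D v e * z e) = 0"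
  shows "z \<in> cycle_space (del_edges G E) D"
proof -
  let ?K = "based_incidence G E D"
  have fin: "finite (edges G)" by (rule wf_graph_finite_edges[OF wf])
  have zE: "z e0 = 0" if e0: "e0 \<in> E" for e0
  proof -
    have EG: "E \<subseteq> edges G" using b unfolding based_def by simp
    define C where "C = {u \<in> verts G. reach G (edge_root G e0) u}"
    have finC: "finite C" unfolding C_def using wf_graphD(1)[OF wf] by simp
    have K: "(\<Sum>u\<in>C. ?K u e) = of_bool (e = e0)" if e: "e \<in> edges G" for e
    proof (cases "e \<in> E")
      case True
      obtain h where h: "h \<in> e" "edge_root G e = inc G h" by (rule edge_root[OF wf e])
      obtain h0 where h0: "h0 \<in> e0" "edge_root G e0 = inc G h0" using edge_root[OF wf] e0 EG by blast
      have "edge_root G e \<in> C \<longleftrightarrow> e = e0"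
        using based_unique[OF wf b e0 True h0(1) h(1)] h h0 reach_refl[of G]
          wf_graph_inc[OF wf wf_graph_edge_hes[OF wf e h(1)]]
        unfolding C_def by auto
      thus ?thesis using True finC by (simp add: based_incidence_def of_bool_def)
    next
      case False
      hence eG': "e \<in> edges (del_edges G E)" using e by (simp add: del_edges_def)
      let ?a = "fst (D e)" and ?c = "snd (D e)"
      have "{?a, ?c} \<in> edges G" using directed_version_mem(3)[OF D eG'] e by argo
      hence "reach G (inc G ?a) (inc G ?c)" by (rule reach_edge)
      moreover have "inc G ?a \<in> verts G" "inc G ?c \<in> verts G"
        using directed_version_mem(1,2)[OF D eG'] wf_graph_inc[OF wf] wf_graph_edge_hes[OF wf e] by blast+
      ultimately have "inc G ?a \<in> C \<longleftrightarrow> inc G ?c \<in> C"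
        unfolding C_def using reach_trans reach_sym by (metis (mono_tags, lifting) mem_Collect_eq)
      thus ?thesis using False finC e0
        by (auto simp: based_incidence_def incidence_def sum_subtractf)
    qed
    have "0 = (\<Sum>u\<in>C. \<Sum>e\<in>edges G. ?K u e * z e)"
      using z unfolding C_def by simp
    also have "\<dots> = (\<Sum>e\<in>edges G. (\<Sum>u\<in>C. ?K u e) * z e)"
      by (subst sum.swap) (simp add: sum_distrib_right)
    also have "\<dots> = (\<Sum>e\<in>edges G. if e = e0 then z e else 0)"
      by (intro sum.cong refl) (simp add: K)
    also have "\<dots> = z e0" using fin e0 EG by auto
    finally show ?thesis by simp
  qed
  have "(\<Sum>e\<in>edges G - E. incidence G D v e * z e) = 0" if "v \<in> verts G" for v
  proof -
    have "(\<Sum>e\<in>edges G - E. incidence G D v e * z e) = (\<Sum>e\<in>edges G. ?K v e * z e)"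
      using fin zE by (intro sum.mono_neutral_cong_left) (auto simp: based_incidence_def)
    thus ?thesis using z[OF that] by simp
  qed
  thus ?thesis unfolding cycle_space_def incidence_del_edges
    using supp zE by (simp add: del_edges_def) blast
qed

text \<open>The identity on edge vectors is the sum of a projection onto the cycle space and of
  \<open>p \<circ> K\<close> for a right inverse \<open>p\<close> of the surjection \<open>K\<close>. Comparing traces gives the dimension.\<close>
lemma card_cycle_basis_del_based:
  assumes wf: "wf_graph G" and reg: "four_regular G" and b: "based G E"
    and D: "directed_version (del_edges G E) D" and B: "cycle_basis (del_edges G E) D B"
  shows "card B = card (verts G)"
proof -
  let ?K = "based_incidence G E D" and ?V = "verts G" and ?S = "edges G"
  define s :: "('b \<times> 'b) list \<Rightarrow> 'b set \<Rightarrow> rat" where "s W e = of_int (sigma (del_edges G E) D W e)" for W e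
  have fin: "finite ?S" "finite ?V" "finite B"
    using wf_graph_finite_edges[OF wf] wf_graphD(1)[OF wf] B unfolding cycle_basis_def by auto
  have "\<forall>v\<in>?V. \<exists>p. \<forall>u. (\<Sum>e\<in>?S. ?K u e * p e) = of_bool (u = v)"
    using based_incidence_surj[OF wf reg b D] by blast
  then obtain p where p: "\<And>u v. v \<in> ?V \<Longrightarrow> (\<Sum>e\<in>?S. ?K u e * p v e) = of_bool (u = v)"
    by (metis bchoice)
  \<comment> \<open>\<open>z e\<close> is the projection of the unit vector of \<open>e\<close>:
    subtracting the chosen preimage of its image under \<open>?K\<close> leaves a kernel vector. The
    value 0 off the edges is demanded by \<open>cycle_space\<close>.\<close>
  define z where "z e e' = (if e' \<in> ?S then of_bool (e' = e) - (\<Sum>v\<in>?V. ?K v e * p v e') else 0)" for e e'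
  have "z e \<in> cycle_space (del_edges G E) D" if e: "e \<in> ?S" for e
  proof (rule based_incidence_kernel[OF wf b D])
    fix u assume u: "u \<in> ?V"
    have "(\<Sum>e'\<in>?S. ?K u e' * z e e')
        = (\<Sum>e'\<in>?S. ?K u e' * of_bool (e' = e)) - (\<Sum>e'\<in>?S. \<Sum>v\<in>?V. ?K v e * (?K u e' * p v e'))"
      by (simp add: z_def right_diff_distrib sum_subtractf sum_distrib_left mult.left_commute)
    also have "(\<Sum>e'\<in>?S. ?K u e' * of_bool (e' = e)) = ?K u e"
      using fin e by (simp add: of_bool_def if_distrib cong: if_cong)
    also have "(\<Sum>e'\<in>?S. \<Sum>v\<in>?V. ?K v e * (?K u e' * p v e')) = (\<Sum>v\<in>?V. ?K v e * of_bool (u = v))"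
      by (subst sum.swap) (simp flip: sum_distrib_left add: p)
    also have "\<dots> = ?K u e"
      using fin u by (simp add: of_bool_def if_distrib cong: if_cong)
    finally show "(\<Sum>e'\<in>?S. ?K u e' * z e e') = 0" by simp
  qed (simp add: z_def)
  hence "\<forall>e\<in>?S. \<exists>c. z e = (\<lambda>e'. \<Sum>W\<in>B. c W * s W e')"
    using B unfolding cycle_basis_def s_def by blast
  then obtain c where c: "\<And>e. e \<in> ?S \<Longrightarrow> z e = (\<lambda>e'. \<Sum>W\<in>B. c e W * s W e')"
    by (metis bchoice)
  have s0: "s W e = 0" if "e \<notin> ?S \<or> e \<in> E" for W e
    using that by (auto simp: s_def sigma_def del_edges_def)
  have Ks: "(\<Sum>e\<in>?S. ?K v e * s W e) = 0" if "W \<in> B" "v \<in> ?V" for W v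
  proof -
    have "(\<Sum>e\<in>?S - E. incidence G D v e * s W e) = 0"
      using B that unfolding cycle_basis_def cycle_space_def incidence_del_edges s_def
      by (simp add: del_edges_def)
    moreover have "(\<Sum>e\<in>?S - E. incidence G D v e * s W e) = (\<Sum>e\<in>?S. ?K v e * s W e)"
      using fin s0 by (intro sum.mono_neutral_cong_left) (auto simp: based_incidence_def)
    ultimately show ?thesis by simp
  qed
  \<comment> \<open>The projection fixes \<open>s W\<close>, because \<open>?K\<close> kills it.
    Expanding the projection through the \<open>z e\<close> and comparing coefficients in the
    independent family gives a unit vector, whose entry at \<open>W\<close> is 1.\<close>
  have diag: "(\<Sum>e\<in>?S. s W e * c e W) = 1" if W: "W \<in> B" for W
  proof -
    define d where "d W' = (\<Sum>e\<in>?S. s W e * c e W') - of_bool (W' = W)" for W'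
    have "(\<Sum>W'\<in>B. d W' * s W' e') = 0" for e'
    proof (cases "e' \<in> ?S")
      case False
      thus ?thesis using s0 by simp
    next
      case True
      have "(\<Sum>W'\<in>B. d W' * s W' e')
          = (\<Sum>W'\<in>B. \<Sum>e\<in>?S. s W e * (c e W' * s W' e')) - (\<Sum>W'\<in>B. of_bool (W' = W) * s W' e')"
        by (simp add: d_def left_diff_distrib sum_subtractf sum_distrib_right mult.assoc)
      also have "(\<Sum>W'\<in>B. of_bool (W' = W) * s W' e') = (\<Sum>W'\<in>B. if W' = W then s W' e' else 0)"
        by (intro sum.cong refl) simp
      also have "\<dots> = s W e'" using fin W by simp
      also have "(\<Sum>W'\<in>B. \<Sum>e\<in>?S. s W e * (c e W' * s W' e')) = (\<Sum>e\<in>?S. s W e * z e e')"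
        by (subst sum.swap) (simp flip: sum_distrib_left add: c)
      also have "\<dots> = (\<Sum>e\<in>?S. s W e * of_bool (e' = e)) - (\<Sum>e\<in>?S. \<Sum>v\<in>?V. p v e' * (?K v e * s W e))"
        using True by (simp add: z_def right_diff_distrib sum_subtractf sum_distrib_left mult_ac)
      also have "(\<Sum>e\<in>?S. s W e * of_bool (e' = e)) = s W e'"
        using fin True by (simp add: of_bool_def if_distrib cong: if_cong)
      also have "(\<Sum>e\<in>?S. \<Sum>v\<in>?V. p v e' * (?K v e * s W e)) = 0"
        by (subst sum.swap) (simp flip: sum_distrib_left add: Ks[OF W])
      finally show ?thesis by simp
    qed
    hence "d W = 0" using B W unfolding cycle_basis_def s_def by blast
    thus ?thesis by (simp add: d_def)
  qed
  \<comment> \<open>A trace does not change when two factors are exchanged: the composite of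
    \<open>?K\<close> and \<open>p\<close> counts the vertices, the projection counts
    \<open>B\<close>, so \<open>card ?S = card ?V + card B\<close>.\<close>
  have "(\<Sum>e\<in>?S. 1) = (\<Sum>e\<in>?S. (\<Sum>v\<in>?V. ?K v e * p v e) + z e e)"
    by (intro sum.cong refl) (simp add: z_def)
  also have "\<dots> = (\<Sum>v\<in>?V. \<Sum>e\<in>?S. ?K v e * p v e) + (\<Sum>e\<in>?S. \<Sum>W\<in>B. s W e * c e W)"
    by (simp add: sum.distrib sum.swap[of _ ?V] c mult.commute)
  also have "(\<Sum>v\<in>?V. \<Sum>e\<in>?S. ?K v e * p v e) = of_nat (card ?V)" by (simp add: p)
  also have "(\<Sum>e\<in>?S. \<Sum>W\<in>B. s W e * c e W) = of_nat (card B)"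
    by (subst sum.swap) (simp add: diag)
  finally have "(of_nat (card ?S) :: rat) = of_nat (card ?V + card B)" by simp
  thus ?thesis using four_regular_card_edges[OF wf reg] unfolding of_nat_eq_iff by simp
qed

subsection \<open>Circuit partitions and the touch-graph\<close>

text \<open>Rotating or reversing a walk preserves its unordered pairs, so one representative
  determines them.\<close>

lemma st_of_walk_class: "st_of (walk_class ws) = (\<lambda>p. {fst p, snd p}) ` set ws"
proof
  show "st_of (walk_class ws) \<subseteq> (\<lambda>p. {fst p, snd p}) ` set ws"
  proof
    fix s assume "s \<in> st_of (walk_class ws)"
    then obtain a b vs where s: "s = {a, b}" "vs \<in> walk_class ws" "(a, b) \<in> set vs"
      unfolding st_of_def by auto
    have "(a, b) \<in> set ws \<or> (b, a) \<in> set ws"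
      using s(2,3) unfolding walk_class_def by (auto simp: set_rotate)
    thus "s \<in> (\<lambda>p. {fst p, snd p}) ` set ws"
      unfolding s(1) by (force simp: insert_commute)
  qed
  have "ws = rotate 0 ws" by simp
  hence "ws \<in> walk_class ws" unfolding walk_class_def by blast
  thus "(\<lambda>p. {fst p, snd p}) ` set ws \<subseteq> st_of (walk_class ws)"
    unfolding st_of_def by fastforce
qed

lemma circuit_partition_circuit:
  assumes "circuit_partition G P" "C \<in> P"
  obtains ws where "circuit_walk G ws" "st_of C = (\<lambda>p. {fst p, snd p}) ` set ws"
  using assms st_of_walk_class unfolding circuit_partition_def is_circuit_def by metis

lemma circuit_partition_single_trans:
  assumes P: "circuit_partition G P" and s: "s \<in> \<Union>(st_of ` P)"
  obtains a b where "s = {a, b}" "dsingle_trans G (a, b)"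
proof -
  obtain C where C: "C \<in> P" "s \<in> st_of C" using s by auto
  obtain ws where ws: "circuit_walk G ws" "st_of C = (\<lambda>p. {fst p, snd p}) ` set ws"
    by (rule circuit_partition_circuit[OF P C(1)])
  obtain p where p: "p \<in> set ws" "s = {fst p, snd p}" using C(2) ws(2) by auto
  have "dsingle_trans G p" using ws(1) p(1) unfolding circuit_walk_def closed_walk_def by blast
  thus ?thesis using that[of "fst p" "snd p"] p(2) by simp
qed

lemma circuit_partition_trans_inc:
  assumes P: "circuit_partition G P" and s: "s \<in> \<Union>(st_of ` P)" and "h \<in> s" "k \<in> s"
  shows "h \<in> hes G" "inc G h = inc G k"
proof -
  obtain a b where ab: "s = {a, b}" "dsingle_trans G (a, b)"
    by (rule circuit_partition_single_trans[OF P s])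
  show "h \<in> hes G" "inc G h = inc G k"
    using ab assms(3,4) unfolding dsingle_trans_def by auto
qed

lemma st_containing_mem:
  assumes P: "circuit_partition G P" and h: "h \<in> hes G"
  shows "st_containing P h \<in> \<Union>(st_of ` P)" "h \<in> st_containing P h"
    and "s \<in> \<Union>(st_of ` P) \<Longrightarrow> h \<in> s \<Longrightarrow> st_containing P h = s"
proof -
  have ex1: "\<exists>!Cs. fst Cs \<in> P \<and> snd Cs \<in> st_of (fst Cs) \<and> h \<in> snd Cs"
    using P h unfolding circuit_partition_def by blast
  then obtain C s0 where s0: "C \<in> P" "s0 \<in> st_of C" "h \<in> s0" by auto
  have uniq: "s = s0" if s: "s \<in> \<Union>(st_of ` P)" "h \<in> s" for s
  proof -
    obtain C' where C': "C' \<in> P" "s \<in> st_of C'" using s(1) by auto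
    have "(C', s) = (C, s0)" by (rule ex1E[OF ex1]) (use s0 C' s(2) in \<open>metis fst_conv snd_conv\<close>)
    thus ?thesis by simp
  qed
  have eq: "st_containing P h = s0" unfolding st_containing_def
    by (rule the_equality) (use s0 uniq in auto)
  show "st_containing P h \<in> \<Union>(st_of ` P)" "h \<in> st_containing P h" unfolding eq using s0 by auto
  show "st_containing P h = s" if "s \<in> \<Union>(st_of ` P)" "h \<in> s" unfolding eq using uniq[OF that] by simp
qed

text \<open>The single transitions of \<open>P\<close> are disjoint pairs of half-edges at a common
  vertex, and a vertex has four half-edges: the pair of some \<open>h\<close> and the pair of some
  \<open>k\<close> outside it use up all of them.\<close>

lemma transition_at_vertex:
  assumes wf: "wf_graph G" and reg: "four_regular G" and P: "circuit_partition G P" and v: "v \<in> verts G"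
  shows "transition_at G v (st_containing P ` {h \<in> hes G. inc G h = v})"
proof -
  let ?H = "{h \<in> hes G. inc G h = v}" and ?st = "st_containing P"
  have card: "card ?H = 4" using reg v unfolding four_regular_def by blast
  have fin: "finite ?H" using wf_graphD(2)[OF wf] by simp
  have st: "single_trans G (?st h)" "?st h \<subseteq> ?H" "card (?st h) = 2" "h \<in> ?st h" "?st h \<in> \<Union>(st_of ` P)"
    if h: "h \<in> ?H" for h
  proof -
    have hG: "h \<in> hes G" using h by simp
    note m = st_containing_mem[OF P hG]
    obtain a b where ab: "?st h = {a, b}" "dsingle_trans G (a, b)"
      by (rule circuit_partition_single_trans[OF P m(1)])
    show "single_trans G (?st h)" unfolding single_trans_def using ab by blast
    show "?st h \<subseteq> ?H"
      using circuit_partition_trans_inc[OF P m(1) _ m(2)] h by auto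
    show "card (?st h) = 2" using ab unfolding dsingle_trans_def by simp
    show "h \<in> ?st h" "?st h \<in> \<Union>(st_of ` P)" using m by blast+
  qed
  have "?H \<noteq> {}" using card by (metis card.empty zero_neq_numeral)
  then obtain h where h: "h \<in> ?H" by blast
  have "card (?H - ?st h) = 2" using card_Diff_subset[OF _ st(2)[OF h]] st(2,3)[OF h] fin card
    by (simp add: finite_subset)
  hence "?H - ?st h \<noteq> {}" by (metis card.empty zero_neq_numeral)
  then obtain k where k: "k \<in> ?H" "k \<notin> ?st h" by blast
  have disj: "?st h \<inter> ?st k = {}"
  proof (rule ccontr)
    assume "?st h \<inter> ?st k \<noteq> {}"
    then obtain l where l: "l \<in> ?st h" "l \<in> ?st k" by blast
    have "l \<in> hes G" using l(1) st(2)[OF h] by blast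
    hence "?st h = ?st k" using st_containing_mem(3)[OF P] l st(5)[OF h] st(5)[OF k(1)] by metis
    thus False using k st(4)[OF k(1)] by simp
  qed
  have un: "?st h \<union> ?st k = ?H"
  proof (rule card_subset_eq[OF fin])
    show "?st h \<union> ?st k \<subseteq> ?H" using st(2)[OF h] st(2)[OF k(1)] by blast
    show "card (?st h \<union> ?st k) = card ?H"
      using card_Un_disjoint[OF _ _ disj] st(3)[OF h] st(3)[OF k(1)] card
        finite_subset[OF st(2)[OF h] fin] finite_subset[OF st(2)[OF k(1)] fin] by simp
  qed
  have "?st ` ?H = {?st h, ?st k}"
  proof
    show "?st ` ?H \<subseteq> {?st h, ?st k}"
    proof (rule image_subsetI)
      fix l assume l: "l \<in> ?H"
      hence "l \<in> ?st h \<or> l \<in> ?st k" using un by blast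
      thus "?st l \<in> {?st h, ?st k}"
        using st_containing_mem(3)[OF P, of l] l st(5)[OF h] st(5)[OF k(1)] by blast
    qed
  qed (use h k in blast)
  thus ?thesis unfolding transition_at_def using st(1)[OF h] st(1)[OF k(1)] disj un by blast
qed

text \<open>At each vertex \<open>P\<close> leaves no choice of transition, so the edges of the
  touch-graph can be indexed by the vertices of \<open>G\<close>. This lets the columns be
  counted.\<close>

lemma tau_eq_image:
  assumes wf: "wf_graph G" and reg: "four_regular G" and P: "circuit_partition G P"
  shows "tau G P = (\<lambda>v. st_containing P ` {h \<in> hes G. inc G h = v}) ` verts G"
proof
  show "(\<lambda>v. st_containing P ` {h \<in> hes G. inc G h = v}) ` verts G \<subseteq> tau G P"
  proof (rule image_subsetI)
    fix v assume v: "v \<in> verts G"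
    show "st_containing P ` {h \<in> hes G. inc G h = v} \<in> tau G P"
      using transition_at_vertex[OF wf reg P v] st_containing_mem(1)[OF P]
      unfolding tau_def by blast
  qed
  show "tau G P \<subseteq> (\<lambda>v. st_containing P ` {h \<in> hes G. inc G h = v}) ` verts G"
  proof
    fix t assume t: "t \<in> tau G P"
    then obtain v s1 s2 where s: "t = {s1, s2}" "single_trans G s1" "single_trans G s2"
      "s1 \<union> s2 = {h \<in> hes G. inc G h = v}" unfolding tau_def transition_at_def by blast
    have mem: "s1 \<in> \<Union>(st_of ` P)" "s2 \<in> \<Union>(st_of ` P)" using t s(1) unfolding tau_def by auto
    obtain h1 h2 where h: "h1 \<in> s1" "h2 \<in> s2" using s(2,3) unfolding single_trans_def by auto
    have st: "st_containing P k = s" if "s \<in> {s1, s2}" "k \<in> s" for k s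
      using st_containing_mem(3)[OF P, of k s] that s(4) mem by auto
    have "st_containing P ` (s1 \<union> s2) = {s1, s2}" using st h by force
    moreover have "h1 \<in> {h \<in> hes G. inc G h = v}" using h(1) s(4) by blast
    hence "v \<in> verts G" using wf_graph_inc[OF wf, of h1] by auto
    ultimately show "t \<in> (\<lambda>v. st_containing P ` {h \<in> hes G. inc G h = v}) ` verts G"
      unfolding s(1) s(4) by blast
  qed
qed

lemma tauE:
  assumes wf: "wf_graph G" and reg: "four_regular G" and P: "circuit_partition G P"
    and v: "v \<in> verts G"
  obtains s1 s2 where "{s1, s2} \<in> tau G P" "s1 \<inter> s2 = {}" "s1 \<union> s2 = {h \<in> hes G. inc G h = v}"
proof -
  let ?t = "st_containing P ` {h \<in> hes G. inc G h = v}"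
  have "?t \<in> tau G P" unfolding tau_eq_image[OF wf reg P] using v by blast
  moreover obtain s1 s2 where "?t = {s1, s2}" "s1 \<inter> s2 = {}" "s1 \<union> s2 = {h \<in> hes G. inc G h = v}"
    using transition_at_vertex[OF wf reg P v] unfolding transition_at_def by blast
  ultimately show ?thesis using that by metis
qed

lemma card_tau:
  assumes wf: "wf_graph G" and reg: "four_regular G" and P: "circuit_partition G P"
  shows "card (tau G P) = card (verts G)"
proof -
  have "inj_on (\<lambda>v. st_containing P ` {h \<in> hes G. inc G h = v}) (verts G)"
  proof (rule inj_onI)
    fix v w assume v: "v \<in> verts G" and eq: "st_containing P ` {h \<in> hes G. inc G h = v}
        = st_containing P ` {h \<in> hes G. inc G h = w}"
    have "card {h \<in> hes G. inc G h = v} = 4" using reg v unfolding four_regular_def by blast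
    hence "{h \<in> hes G. inc G h = v} \<noteq> {}" by (metis card.empty zero_neq_numeral)
    then obtain h where h: "h \<in> hes G" "inc G h = v" by blast
    then obtain k where k: "k \<in> hes G" "inc G k = w" "st_containing P h = st_containing P k"
      using eq by blast
    show "v = w"
      using circuit_partition_trans_inc(2)[OF P st_containing_mem(1)[OF P h(1)], of h k]
        st_containing_mem(2)[OF P h(1)] st_containing_mem(2)[OF P k(1)] h k by simp
  qed
  thus ?thesis unfolding tau_eq_image[OF wf reg P] by (rule card_image)
qed

text \<open>Walks through a vertex enter and leave it equally often, so the signed number of passages
  from the first to the second single transition is the net flow into the first one.\<close>
lemma sigma_pi_eq_sum_wflow:
  assumes wf: "wf_graph G" and P: "circuit_partition G P"
    and D: "directed_version (touch_graph G P) D" and t: "t \<in> tau G P"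
    and W: "\<And>p. p \<in> set W \<Longrightarrow> dsingle_trans G p"
  shows "sigma_pi P D W t = (\<Sum>h\<in>fst (D t). wflow W h)"
proof -
  obtain s1 s2 where D_t: "D t = (s1, s2)" by fastforce
  have t_eq: "t = {s1, s2}"
    using D t D_t unfolding directed_version_def touch_graph_def by (metis fst_conv snd_conv select_convs(3))
  obtain v r1 r2 where r: "t = {r1, r2}" "single_trans G r1" "single_trans G r2"
    "r1 \<inter> r2 = {}" "r1 \<union> r2 = {h \<in> hes G. inc G h = v}" using t unfolding tau_def transition_at_def by blast
  have r12: "(s1 = r1 \<and> s2 = r2) \<or> (s1 = r2 \<and> s2 = r1)"
    using t_eq r(1) by (metis doubleton_eq_iff)
  have s: "single_trans G s1" "s1 \<inter> s2 = {}" "s1 \<union> s2 = {h \<in> hes G. inc G h = v}"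
    using r12 r by auto
  have mem: "s1 \<in> \<Union>(st_of ` P)" "s2 \<in> \<Union>(st_of ` P)" using t t_eq unfolding tau_def by auto
  have ne: "s1 \<noteq> s2" using s(1,2) unfolding single_trans_def by auto
  have iff: "st_containing P h = s1 \<longleftrightarrow> h \<in> s1" "st_containing P h = s2 \<longleftrightarrow> h \<in> s2" if "h \<in> hes G" for h
    using st_containing_mem(2,3)[OF P that] mem by blast+
  have fin: "finite s1" using s(3) wf_graphD(2)[OF wf] by (metis finite_Collect_conjI finite_Un Collect_mem_eq)
  have "sigma_pi P D W t = (\<Sum>p\<leftarrow>W. of_bool (fst p \<in> s1) - of_bool (snd p \<in> s1))"
    using W
  proof (induction W)
    case Nil
    show ?case by (simp add: sigma_pi_def sigma_t_def pi_P_def)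
  next
    case (Cons p W)
    have p: "fst p \<in> hes G" "snd p \<in> hes G" "inc G (fst p) = inc G (snd p)"
      using Cons.prems unfolding dsingle_trans_def by auto
    \<comment> \<open>\<open>s1\<close> and \<open>s2\<close> together are all half-edges at one
      vertex, and a transition has both its half-edges there or neither.\<close>
    have v: "fst p \<in> s1 \<or> fst p \<in> s2 \<longleftrightarrow> snd p \<in> s1 \<or> snd p \<in> s2"
      using s(3) p by (metis (mono_tags, lifting) Un_iff mem_Collect_eq)
    have nb: "\<not> (h \<in> s1 \<and> h \<in> s2)" for h using s(2) by blast
    \<comment> \<open>The pairs deleted by \<open>pi_P\<close> have equal components and never match
      \<open>(s1, s2)\<close> or its swap.\<close>
    have "sigma_pi P D (p # W) t = sigma_pi P D W t
      + (of_bool (st_containing P (fst p) = s1 \<and> st_containing P (snd p) = s2)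
      - of_bool (st_containing P (fst p) = s2 \<and> st_containing P (snd p) = s1))"
      using ne by (auto simp: sigma_pi_def sigma_t_def pi_P_def D_t)
    also have "\<dots> = sigma_pi P D W t
      + (of_bool (fst p \<in> s1 \<and> snd p \<in> s2) - of_bool (fst p \<in> s2 \<and> snd p \<in> s1))"
      unfolding iff[OF p(1)] iff[OF p(2)] ..
    also have "of_bool (fst p \<in> s1 \<and> snd p \<in> s2) - of_bool (fst p \<in> s2 \<and> snd p \<in> s1)
      = (of_bool (fst p \<in> s1) - of_bool (snd p \<in> s1) :: int)"
      using v nb[of "fst p"] nb[of "snd p"]
      by (cases "fst p \<in> s1"; cases "snd p \<in> s1") simp_all
    also have "sigma_pi P D W t = (\<Sum>p\<leftarrow>W. of_bool (fst p \<in> s1) - of_bool (snd p \<in> s1))"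
      using Cons by simp
    finally show ?case by simp
  qed
  thus ?thesis unfolding D_t using sum_wflow[OF fin, of W] by simp
qed

subsection \<open>Determinants\<close>

text \<open>Row \<open>j\<close> of the adjugate divided by the determinant combines the rows of
  \<open>A\<close> to the \<open>j\<close>-th unit vector, so its entries are integers by
  assumption. Thus \<open>A\<close> has an integer inverse and its determinant divides 1.\<close>

lemma det_abs_le_1_if_integral_row_combinations:
  fixes A :: "int mat"
  assumes A: "A \<in> carrier_mat n n"
    and int: "\<And>c :: nat \<Rightarrow> rat. (\<And>k. k < n \<Longrightarrow> (\<Sum>i<n. c i * of_int (A $$ (i, k))) \<in> \<int>)
      \<Longrightarrow> (\<And>i. i < n \<Longrightarrow> c i \<in> \<int>)"
  shows "det A \<in> {-1, 0, 1}"
proof (cases "det A = 0")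
  case False
  let ?B = "adj_mat A" and ?d = "det A"
  have B: "?B \<in> carrier_mat n n" "?B * A = ?d \<cdot>\<^sub>m 1\<^sub>m n" using adj_mat[OF A] by auto
  have entry: "(\<Sum>i<n. ?B $$ (j, i) * A $$ (i, k)) = ?d * of_bool (j = k)" if "j < n" "k < n" for j k
  proof -
    have "(?B * A) $$ (j, k) = (\<Sum>i<n. ?B $$ (j, i) * A $$ (i, k))"
      using that A B(1) by (simp add: scalar_prod_def atLeast0LessThan)
    thus ?thesis using that unfolding B(2) by (cases "j = k") simp_all
  qed
  have "of_int (?B $$ (j, i)) / of_int ?d \<in> (\<int> :: rat set)" if j: "j < n" and i: "i < n" for j i
  proof (rule int[OF _ i])
    fix k assume k: "k < n"
    have "(\<Sum>i<n. of_int (?B $$ (j, i)) / of_int ?d * (of_int (A $$ (i, k)) :: rat))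
        = of_int (\<Sum>i<n. ?B $$ (j, i) * A $$ (i, k)) / of_int ?d"
      by (simp add: sum_divide_distrib)
    also have "\<dots> = of_bool (j = k)" unfolding entry[OF j k] using False by simp
    finally show "(\<Sum>i<n. of_int (?B $$ (j, i)) / of_int ?d * (of_int (A $$ (i, k)) :: rat)) \<in> \<int>"
      by simp
  qed
  hence "\<forall>j\<in>{..<n}. \<forall>i\<in>{..<n}. \<exists>m. ?B $$ (j, i) = ?d * m"
    using False by (fastforce elim!: Ints_cases simp: field_simps simp flip: of_int_mult)
  then obtain m where m: "\<And>j i. j < n \<Longrightarrow> i < n \<Longrightarrow> ?B $$ (j, i) = ?d * m j i"
    by (metis lessThan_iff)
  define M where "M = mat n n (\<lambda>(j, i). m j i)"
  have M: "M \<in> carrier_mat n n" unfolding M_def by simp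
  have "M * A = 1\<^sub>m n"
  proof (rule eq_matI)
    fix j k assume jk: "j < dim_row (1\<^sub>m n :: int mat)" "k < dim_col (1\<^sub>m n :: int mat)"
    have "?d * (M * A) $$ (j, k) = (\<Sum>i<n. ?B $$ (j, i) * A $$ (i, k))"
      using jk A by (simp add: M_def scalar_prod_def atLeast0LessThan sum_distrib_left m mult.assoc)
    also have "\<dots> = ?d * (1\<^sub>m n) $$ (j, k)" using jk by (simp add: entry)
    finally show "(M * A) $$ (j, k) = 1\<^sub>m n $$ (j, k)" using False by simp
  qed (use M A in auto)
  hence "det M * det A = 1" using det_mult[OF M A] by simp
  hence "\<bar>det A\<bar> = 1" by (metis zmult_eq_1_iff mult.commute abs_1 abs_minus)
  thus ?thesis by auto
qed simp

section \<open>Circuits of the partition against the deleted edges\<close>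

lemma dsingle_trans_del_edges: "dsingle_trans (del_edges G E) p \<Longrightarrow> dsingle_trans G p"
  unfolding dsingle_trans_def del_edges_def by auto

text \<open>No half-edge repeats in a circuit, so the arrival through its first half-edge is not
  cancelled. This certifies that a circuit is a nonzero cycle.\<close>

lemma wflow_circuit:
  assumes ws: "circuit_walk G ws"
  shows "\<exists>h. wflow ws h = 1"
proof -
  obtain p ws' where p: "ws = p # ws'" using ws unfolding circuit_walk_def by (cases ws) auto
  have q: "fst q \<noteq> fst p \<and> snd q \<noteq> fst p" if "q \<in> set ws'" for q
    using ws that unfolding circuit_walk_def p by auto
  moreover have "fst p \<noteq> snd p" using ws unfolding circuit_walk_def p by auto
  moreover have "(\<Sum>q\<leftarrow>ws'. of_bool (fst q = fst p) - of_bool (snd q = fst p)) = (\<Sum>q\<leftarrow>ws'. (0::int))"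
    using q by (intro arg_cong[where f = sum_list] map_cong refl) simp
  ultimately have "wflow ws (fst p) = 1" unfolding p wflow_def by simp
  thus ?thesis ..
qed

lemma closed_walk_del_edges:
  assumes wf: "wf_graph G" and W: "closed_walk G W"
    and E: "\<And>p e. p \<in> set W \<Longrightarrow> e \<in> E \<Longrightarrow> e \<in> edges G \<Longrightarrow> fst p \<notin> e \<and> snd p \<notin> e"
  shows "closed_walk (del_edges G E) W"
  unfolding closed_walk_def
proof (intro conjI ballI allI impI)
  fix p assume "p \<in> set W"
  thus "dsingle_trans (del_edges G E) p"
    using W E[of p] unfolding closed_walk_def dsingle_trans_def del_edges_def by auto
next
  fix i assume i: "i < length W"
  hence "{snd (W ! i), fst (W ! ((i + 1) mod length W))} \<in> edges G"
    using W unfolding closed_walk_def by blast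
  thus "{snd (W ! i), fst (W ! ((i + 1) mod length W))} \<in> edges (del_edges G E)"
    using E[OF nth_mem[OF i]] unfolding del_edges_def by auto
qed

text \<open>Integrality passes through a transition because the sum of its two values is integral,
  and across an edge because only the sign changes; from one half-edge it travels round the whole
  walk.\<close>

lemma circuit_flow_Ints:
  fixes \<phi> :: "'h \<Rightarrow> rat"
  assumes ws: "closed_walk G ws" and anti: "\<And>a b. {a, b} \<in> edges G \<Longrightarrow> \<phi> b = - \<phi> a"
    and trans: "\<And>p. p \<in> set ws \<Longrightarrow> \<phi> (fst p) + \<phi> (snd p) \<in> \<int>"
    and p: "p \<in> set ws" "\<phi> (fst p) \<in> \<int> \<or> \<phi> (snd p) \<in> \<int>" and q: "q \<in> set ws"
  shows "\<phi> (fst q) \<in> \<int>" "\<phi> (snd q) \<in> \<int>"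
proof -
  have snd_iff: "\<phi> (snd r) \<in> \<int> \<longleftrightarrow> \<phi> (fst r) \<in> \<int>" if "r \<in> set ws" for r
    using trans[OF that] Ints_diff[OF trans[OF that], of "\<phi> (fst r)"]
      Ints_diff[OF trans[OF that], of "\<phi> (snd r)"] by auto
  let ?n = "length ws"
  obtain j where j: "j < ?n" "p = ws ! j" using p(1) by (metis in_set_conv_nth)
  obtain i where i: "i < ?n" "q = ws ! i" using q by (metis in_set_conv_nth)
  have "\<phi> (fst (ws ! ((j + k) mod ?n))) \<in> \<int>" for k
  proof (induction k)
    case 0
    show ?case using p snd_iff j by auto
  next
    case (Suc k)
    let ?i = "(j + k) mod ?n"
    have lt: "?i < ?n" using j(1) by (intro mod_less_divisor) linarith
    have "{snd (ws ! ?i), fst (ws ! ((?i + 1) mod ?n))} \<in> edges G"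
      using ws lt unfolding closed_walk_def by blast
    hence "\<phi> (fst (ws ! ((?i + 1) mod ?n))) = - \<phi> (snd (ws ! ?i))" by (rule anti)
    moreover have "(?i + 1) mod ?n = (j + Suc k) mod ?n" by (simp add: mod_Suc_eq)
    ultimately show ?case using Suc snd_iff[OF nth_mem[OF lt]] by simp
  qed
  \<comment> \<open>From position \<open>j\<close>, \<open>?n - j\<close> steps return to the start
    of the list and \<open>i\<close> more reach \<open>q\<close>.\<close>
  from this[of "?n - j + i"] show "\<phi> (fst q) \<in> \<int>" using i j(1) by simp
  thus "\<phi> (snd q) \<in> \<int>" using snd_iff[OF q] by simp
qed

lemma cycle_basis_independent:
  fixes c :: "('h \<times> 'h) list \<Rightarrow> rat"
  assumes B: "cycle_basis G D B" and z: "\<And>e. (\<Sum>W\<in>B. c W * of_int (sigma G D W e)) = 0" and W: "W \<in> B"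
  shows "c W = 0"
proof -
  have "\<forall>c :: ('h \<times> 'h) list \<Rightarrow> rat. (\<lambda>e. \<Sum>W\<in>B. c W * of_int (sigma G D W e)) = (\<lambda>e. 0)
      \<longrightarrow> (\<forall>W\<in>B. c W = 0)"
    using B unfolding cycle_basis_def by blast
  from spec[OF this, of c] show ?thesis using z W by simp
qed

text \<open>Integral values of the cycle with coefficients \<open>c\<close> do not by themselves
  make \<open>c\<close> integral. They give a second expansion of the same cycle, with integer
  coefficients, and independence over the rationals identifies the two.\<close>

lemma integral_basis_coeffs_Ints:
  fixes c :: "('h \<times> 'h) list \<Rightarrow> rat" and D :: "'h set set \<Rightarrow> 'h set \<times> 'h set"
  assumes wf: "wf_graph F" and reg: "four_regular F" and P: "circuit_partition F P"
    and D: "directed_version (touch_graph F P) D"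
    and D0: "directed_version (del_edges F E) D0" and B: "integral_cycle_basis (del_edges F E) D0 B"
    and meets: "\<And>ws. circuit_walk F ws \<Longrightarrow> (\<lambda>p. {fst p, snd p}) ` set ws \<in> st_of ` P
      \<Longrightarrow> \<exists>p\<in>set ws. \<exists>e\<in>E \<inter> edges F. fst p \<in> e \<or> snd p \<in> e"
    and c: "\<And>t. t \<in> tau F P \<Longrightarrow> (\<Sum>W\<in>B. c W * of_int (sigma_pi P D W t)) \<in> \<int>"
    and W0: "W0 \<in> B"
  shows "c W0 \<in> \<int>"
proof -
  let ?G = "del_edges F E"
  have wfG: "wf_graph ?G" by (rule wf_graph_del_edges[OF wf])
  have cb: "cycle_basis ?G D0 B" using B unfolding integral_cycle_basis_def by blast
  have BW: "closed_walk ?G W" if "W \<in> B" for W using cb that unfolding cycle_basis_def by blast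
  have BF: "dsingle_trans F p" if "W \<in> B" "p \<in> set W" for W p
    using BW[OF that(1)] that(2) dsingle_trans_del_edges unfolding closed_walk_def by blast
  define x where "x e = (\<Sum>W\<in>B. c W * of_int (sigma ?G D0 W e))" for e
  define \<phi> where "\<phi> = hflow (edges ?G) D0 x"
  have \<phi>: "\<phi> h = (\<Sum>W\<in>B. c W * of_int (wflow W h))" for h
    unfolding \<phi>_def x_def hflow_sum hflow_of_int
    by (intro sum.cong refl) (simp add: hflow_sigma[OF wfG D0 BW])
  have sum\<phi>: "(\<Sum>h\<in>A. \<phi> h) = (\<Sum>W\<in>B. c W * of_int (\<Sum>h\<in>A. wflow W h))" for A
    unfolding \<phi> by (subst sum.swap) (simp add: sum_distrib_left)
  \<comment> \<open>On a deleted edge both flows are 0, so the sign rule holds on all edges of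
    \<open>F\<close>.\<close>
  have anti: "\<phi> b = - \<phi> a" if ab: "{a, b} \<in> edges F" for a b
  proof (cases "{a, b} \<in> E")
    case True
    hence "a \<notin> hes ?G" "b \<notin> hes ?G" using hes_del_edges_iff[OF wf ab] by simp_all
    thus ?thesis unfolding \<phi>_def by (simp add: hflow_outside[OF wfG D0])
  next
    case False
    hence "{a, b} \<in> edges ?G" using ab by (simp add: del_edges_def)
    thus ?thesis unfolding \<phi>_def by (rule hflow_edge[OF wfG D0])
  qed
  have sum_vertex: "(\<Sum>h | h \<in> hes F \<and> inc F h = v. \<phi> h) = 0" for v
    unfolding sum\<phi> using sum_wflow_vertex[OF wf BF] by (intro sum.neutral) simp
  have trans: "(\<Sum>h\<in>s. \<phi> h) \<in> \<int>" if s: "s \<in> \<Union>(st_of ` P)" for s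
  proof -
    obtain a b where ab: "s = {a, b}" "dsingle_trans F (a, b)"
      by (rule circuit_partition_single_trans[OF P s])
    have a: "a \<in> hes F" "a \<in> s" using ab unfolding dsingle_trans_def by auto
    obtain s1 s2 where t: "{s1, s2} \<in> tau F P" "s1 \<inter> s2 = {}"
      "s1 \<union> s2 = {h \<in> hes F. inc F h = inc F a}"
      by (rule tauE[OF wf reg P wf_graph_inc[OF wf a(1)]])
    have "a \<in> s1 \<or> a \<in> s2" using t(3) a(1) by blast
    moreover have "s1 \<in> \<Union>(st_of ` P)" "s2 \<in> \<Union>(st_of ` P)" using t(1) unfolding tau_def by auto
    ultimately have s12: "s = s1 \<or> s = s2" using st_containing_mem(3)[OF P a(1)] s a(2) by metis
    have "finite (s1 \<union> s2)" unfolding t(3) using wf_graphD(2)[OF wf] by simp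
    hence "(\<Sum>h\<in>s1. \<phi> h) + (\<Sum>h\<in>s2. \<phi> h) = 0"
      using sum_vertex[of "inc F a"] t(2) unfolding t(3)[symmetric, simplified]
      by (simp add: sum.union_disjoint)
    hence neg: "(\<Sum>h\<in>s2. \<phi> h) = - (\<Sum>h\<in>s1. \<phi> h)" by linarith
    \<comment> \<open>The matrix sees only the half that \<open>D\<close> puts first; by
      \<open>neg\<close> the flow into the other half is integral as well.\<close>
    have "(\<Sum>h\<in>fst (D {s1, s2}). \<phi> h) = (\<Sum>W\<in>B. c W * of_int (sigma_pi P D W {s1, s2}))"
      unfolding sum\<phi> by (intro sum.cong refl) (simp add: sigma_pi_eq_sum_wflow[OF wf P D t(1) BF])
    hence "(\<Sum>h\<in>fst (D {s1, s2}). \<phi> h) \<in> \<int>" using c[OF t(1)] by simp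
    moreover have "fst (D {s1, s2}) = s1 \<or> fst (D {s1, s2}) = s2"
      using directed_version_mem(1)[OF D, of "{s1, s2}"] t(1) by (simp add: touch_graph_def)
    ultimately have "(\<Sum>h\<in>s1. \<phi> h) \<in> \<int>" using neg by (metis Ints_minus minus_minus)
    thus ?thesis using s12 neg by (metis Ints_minus)
  qed
  have \<phi>_Ints: "\<phi> h \<in> \<int>" if h: "h \<in> hes F" for h
  proof -
    obtain C where C: "C \<in> P" "st_containing P h \<in> st_of C"
      using st_containing_mem(1)[OF P h] by blast
    obtain ws where ws: "circuit_walk F ws" "st_of C = (\<lambda>p. {fst p, snd p}) ` set ws"
      by (rule circuit_partition_circuit[OF P C(1)])
    have cw: "closed_walk F ws" using ws(1) unfolding circuit_walk_def by blast
    obtain q where q: "q \<in> set ws" "h = fst q \<or> h = snd q"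
      using C(2) st_containing_mem(2)[OF P h] unfolding ws(2) by auto
    obtain p e where p: "p \<in> set ws" "e \<in> E \<inter> edges F" "fst p \<in> e \<or> snd p \<in> e"
      using meets[OF ws(1)] C(1) unfolding ws(2)[symmetric] by blast
    have tr: "\<phi> (fst r) + \<phi> (snd r) \<in> \<int>" if r: "r \<in> set ws" for r
    proof -
      have "fst r \<noteq> snd r" using cw r unfolding closed_walk_def dsingle_trans_def by blast
      moreover have "{fst r, snd r} \<in> \<Union>(st_of ` P)" using C(1) ws(2) r by blast
      ultimately show ?thesis using trans[of "{fst r, snd r}"] by simp
    qed
    \<comment> \<open>The starting value of the propagation: a half-edge of the deleted edge
      \<open>e\<close> carries flow 0.\<close>
    have "fst p \<notin> hes ?G \<or> snd p \<notin> hes ?G"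
      using p(2,3) hes_del_edges_iff[OF wf, of e _ E] by blast
    hence "\<phi> (fst p) = 0 \<or> \<phi> (snd p) = 0"
      unfolding \<phi>_def using hflow_outside[OF wfG D0] by blast
    hence "\<phi> (fst p) \<in> \<int> \<or> \<phi> (snd p) \<in> \<int>" by auto
    from circuit_flow_Ints[OF cw anti tr p(1) this q(1)] show ?thesis using q(2) by blast
  qed
  have x0: "x e = 0" if "e \<notin> edges ?G" for e using that unfolding x_def sigma_def by simp
  have x_Ints: "x e \<in> \<int>" for e
  proof (cases "e \<in> edges ?G")
    case True
    have "snd (D0 e) \<in> hes ?G"
      using wf_graph_edge_hes[OF wfG True directed_version_mem(2)[OF D0 True]] .
    hence "snd (D0 e) \<in> hes F" unfolding del_edges_def by simp
    thus ?thesis using \<phi>_Ints[of "snd (D0 e)"] hflow_head[OF wfG D0 True, of x] unfolding \<phi>_def by simp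
  qed (simp add: x0)
  define y where "y e = \<lfloor>x e\<rfloor>" for e
  have y: "x = (\<lambda>e. of_int (y e))"
  proof
    fix e
    show "x e = of_int (y e)" using x_Ints[of e] unfolding y_def by (elim Ints_cases) simp
  qed
  have "(\<Sum>h | h \<in> hes ?G \<and> inc ?G h = v. \<phi> h) = 0" for v
    unfolding sum\<phi> using sum_wflow_vertex[OF wfG] BW unfolding closed_walk_def
    by (intro sum.neutral) simp
  hence "x \<in> cycle_space ?G D0"
    unfolding cycle_space_iff_hflow[OF wfG D0] \<phi>_def using x0 by blast
  hence "circulation ?G D0 y" unfolding circulation_iff_cycle_space[OF wfG D0] y .
  from circulation_in_integral_span[OF wfG D0 B this]
  obtain m :: "('h \<times> 'h) list \<Rightarrow> int" where m: "y = (\<lambda>e. \<Sum>W\<in>B. m W * sigma ?G D0 W e)" by blast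
  have "(\<Sum>W\<in>B. (c W - of_int (m W)) * of_int (sigma ?G D0 W e)) = 0" for e
  proof -
    have "(\<Sum>W\<in>B. (c W - of_int (m W)) * of_int (sigma ?G D0 W e)) = x e - of_int (y e)"
      unfolding m x_def by (simp add: left_diff_distrib sum_subtractf)
    thus ?thesis unfolding y by simp
  qed
  hence "c W0 - of_int (m W0) = 0"
    by (rule cycle_basis_independent[OF cb _ W0])
  thus ?thesis by simp
qed

text \<open>A circuit of \<open>P\<close> avoiding \<open>E\<close> is a nonzero cycle of \<open>F - E\<close> that never changes its
  circuit, so it projects to the zero vector and yields a linear relation between the rows.\<close>
lemma row_relation_if_circuit_avoids:
  assumes wf: "wf_graph F" and P: "circuit_partition F P"
    and D: "directed_version (touch_graph F P) D"
    and D0: "directed_version (del_edges F E) D0" and B: "integral_cycle_basis (del_edges F E) D0 B"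
    and ws: "circuit_walk F ws" "(\<lambda>p. {fst p, snd p}) ` set ws \<in> st_of ` P"
    and avoid: "\<And>p e. p \<in> set ws \<Longrightarrow> e \<in> E \<Longrightarrow> e \<in> edges F \<Longrightarrow> fst p \<notin> e \<and> snd p \<notin> e"
  shows "\<exists>c :: _ \<Rightarrow> int. (\<exists>W\<in>B. c W \<noteq> 0) \<and> (\<forall>t\<in>tau F P. (\<Sum>W\<in>B. c W * sigma_pi P D W t) = 0)"
proof -
  let ?G = "del_edges F E"
  have wfG: "wf_graph ?G" by (rule wf_graph_del_edges[OF wf])
  have cwF: "closed_walk F ws" using ws(1) unfolding circuit_walk_def by blast
  have cw: "closed_walk ?G ws" by (rule closed_walk_del_edges[OF wf cwF avoid])
  have BW: "closed_walk ?G W" if "W \<in> B" for W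
    using B that unfolding integral_cycle_basis_def cycle_basis_def by blast
  \<comment> \<open>The coefficients of the circuit in the integral basis serve as the row
    relation.\<close>
  obtain c :: "_ \<Rightarrow> int" where c: "sigma ?G D0 ws = (\<lambda>e. \<Sum>W\<in>B. c W * sigma ?G D0 W e)"
    using B cw unfolding integral_cycle_basis_def by blast
  have wfl: "wflow ws h = (\<Sum>W\<in>B. c W * wflow W h)" for h
    using hflow_sigma[OF wfG D0 cw, of h] unfolding c hflow_sum
    by (simp add: hflow_sigma[OF wfG D0 BW])
  have ds: "dsingle_trans F p" if "closed_walk ?G W" "p \<in> set W" for W p
    using that dsingle_trans_del_edges unfolding closed_walk_def by blast
  have "st_containing P (fst p) = st_containing P (snd p)" if p: "p \<in> set ws" for p
  proof -
    have "{fst p, snd p} \<in> \<Union>(st_of ` P)" using ws(2) p by blast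
    moreover have "fst p \<in> hes F" "snd p \<in> hes F" using ds[OF cw p] unfolding dsingle_trans_def by auto
    ultimately show ?thesis using st_containing_mem(3)[OF P] by (metis insertI1 insertI2)
  qed
  hence "pi_P P ws = []" unfolding pi_P_def by (auto simp: filter_empty_conv)
  hence "sigma_pi P D ws t = 0" for t unfolding sigma_pi_def sigma_t_def by simp
  moreover have "sigma_pi P D ws t = (\<Sum>W\<in>B. c W * sigma_pi P D W t)" if t: "t \<in> tau F P" for t
  proof -
    have "sigma_pi P D ws t = (\<Sum>h\<in>fst (D t). \<Sum>W\<in>B. c W * wflow W h)"
      using sigma_pi_eq_sum_wflow[OF wf P D t, of ws] ds[OF cw] wfl by simp
    also have "\<dots> = (\<Sum>W\<in>B. c W * sigma_pi P D W t)"
      by (subst sum.swap) (simp add: sigma_pi_eq_sum_wflow[OF wf P D t ds[OF BW]] sum_distrib_left)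
    finally show ?thesis .
  qed
  moreover have "\<exists>W\<in>B. c W \<noteq> 0"
  proof (rule ccontr)
    assume "\<not> ?thesis"
    hence "wflow ws h = 0" for h unfolding wfl by simp
    thus False using wflow_circuit[OF ws(1)] by simp
  qed
  ultimately show ?thesis by auto
qed

text \<open>Rows and columns carry no order, so the bound is stated for all enumerations
  \<open>f\<close> and \<open>g\<close>; changing them can only change the sign.\<close>

theorem mainTheorem15:
  fixes F :: "('v,'h) hgraph"
    and P :: "('h \<times> 'h) list set set"
    and D :: "'h set set \<Rightarrow> 'h set \<times> 'h set"
    and E :: "'h set set"
    and D0 :: "'h set \<Rightarrow> 'h \<times> 'h"
    and \<Gamma> :: "('h \<times> 'h) list set"
  assumes "wf_graph F"
    and "four_regular F"
    and "circuit_partition F P"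
    and "directed_version (touch_graph F P) D"
    and "based F E"
    and "directed_version (del_edges F E) D0"
    and "integral_cycle_basis (del_edges F E) D0 \<Gamma>"
  shows "card \<Gamma> = card (tau F P) \<and>
    (\<forall>f g. bij_betw f {..<card \<Gamma>} \<Gamma> \<longrightarrow> bij_betw g {..<card \<Gamma>} (tau F P) \<longrightarrow>
       det (mat (card \<Gamma>) (card \<Gamma>) (\<lambda>(i,j). sigma_pi P D (f i) (g j))) \<in> {-1, 0, 1})"
proof (intro conjI allI impI)
  have "cycle_basis (del_edges F E) D0 \<Gamma>" using assms(7) unfolding integral_cycle_basis_def by blast
  from card_cycle_basis_del_based[OF assms(1,2,5,6) this]
  show "card \<Gamma> = card (tau F P)" unfolding card_tau[OF assms(1-3)] .
next
  fix f g assume f: "bij_betw f {..<card \<Gamma>} \<Gamma>" and g: "bij_betw g {..<card \<Gamma>} (tau F P)"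
  let ?n = "card \<Gamma>"
  let ?A = "mat ?n ?n (\<lambda>(i,j). sigma_pi P D (f i) (g j))"
  have gt: "g k \<in> tau F P" if "k < ?n" for k using g that unfolding bij_betw_def by auto
  have A: "?A \<in> carrier_mat ?n ?n" by simp
  show "det ?A \<in> {-1, 0, 1}"
  proof (cases "\<forall>ws. circuit_walk F ws \<longrightarrow> (\<lambda>p. {fst p, snd p}) ` set ws \<in> st_of ` P
      \<longrightarrow> (\<exists>p\<in>set ws. \<exists>e\<in>E \<inter> edges F. fst p \<in> e \<or> snd p \<in> e)")
    case True
    show ?thesis
    proof (rule det_abs_le_1_if_integral_row_combinations[OF A])
      fix c :: "nat \<Rightarrow> rat" and i
      assume c: "\<And>k. k < ?n \<Longrightarrow> (\<Sum>i<?n. c i * of_int (?A $$ (i, k))) \<in> \<int>" and i: "i < ?n"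
      \<comment> \<open>Row coefficients become coefficients of basis elements through the inverse
        of \<open>f\<close>.\<close>
      let ?f' = "the_inv_into {..<?n} f"
      have inv: "?f' (f j) = j" if "j < ?n" for j
        using f that by (auto simp: bij_betw_def the_inv_into_f_f)
      have "c (?f' (f i)) \<in> \<int>"
      proof (rule integral_basis_coeffs_Ints[OF assms(1-4,6,7), where c = "\<lambda>W. c (?f' W)"])
        fix t assume "t \<in> tau F P"
        then obtain k where k: "k < ?n" "t = g k" using g unfolding bij_betw_def by auto
        have "(\<Sum>W\<in>\<Gamma>. c (?f' W) * of_int (sigma_pi P D W t))
            = (\<Sum>j<?n. c (?f' (f j)) * of_int (sigma_pi P D (f j) t))"
          by (rule sum.reindex_bij_betw[OF f, symmetric])
        also have "\<dots> = (\<Sum>j<?n. c j * of_int (?A $$ (j, k)))"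
          using k inv by (intro sum.cong refl) simp
        finally show "(\<Sum>W\<in>\<Gamma>. c (?f' W) * of_int (sigma_pi P D W t)) \<in> \<int>"
          using c[OF k(1)] by simp
      next
        show "f i \<in> \<Gamma>" using bij_betwE[OF f] i by simp
      qed (rule True[rule_format])
      thus "c i \<in> \<int>" using inv[OF i] by simp
    qed
  next
    case False
    then obtain ws where ws: "circuit_walk F ws" "(\<lambda>p. {fst p, snd p}) ` set ws \<in> st_of ` P"
      and "\<not> (\<exists>p\<in>set ws. \<exists>e\<in>E \<inter> edges F. fst p \<in> e \<or> snd p \<in> e)"
      unfolding not_all not_imp by (elim exE conjE)
    hence avoid: "fst p \<notin> e \<and> snd p \<notin> e" if "p \<in> set ws" "e \<in> E" "e \<in> edges F" for p e
      using that by simp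
    have "\<exists>c :: _ \<Rightarrow> int. (\<exists>W\<in>\<Gamma>. c W \<noteq> 0) \<and> (\<forall>t\<in>tau F P. (\<Sum>W\<in>\<Gamma>. c W * sigma_pi P D W t) = 0)"
      by (rule row_relation_if_circuit_avoids[OF assms(1,3,4,6,7) ws]) (rule avoid)
    then obtain c :: "_ \<Rightarrow> int" where c: "\<exists>W\<in>\<Gamma>. c W \<noteq> 0"
      "\<forall>t\<in>tau F P. (\<Sum>W\<in>\<Gamma>. c W * sigma_pi P D W t) = 0" by (elim exE conjE)
    define v where "v = vec ?n (\<lambda>i. c (f i))"
    obtain W where W: "W \<in> \<Gamma>" "c W \<noteq> 0" using c(1) by (rule bexE)
    have "W \<in> f ` {..<?n}" using W(1) bij_betw_imp_surj_on[OF f] by simp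
    then obtain i where "i < ?n" "W = f i" by auto
    hence "i < ?n" "c (f i) \<noteq> 0" using W(2) by simp_all
    hence "v \<noteq> 0\<^sub>v ?n" unfolding v_def by (metis index_vec index_zero_vec(1))
    \<comment> \<open>A relation between rows is a kernel vector of the transpose, which has the
      same determinant.\<close>
    moreover have "transpose_mat ?A *\<^sub>v v = 0\<^sub>v ?n"
    proof (rule eq_vecI)
      fix k assume "k < dim_vec (0\<^sub>v ?n :: int vec)"
      hence k: "k < ?n" by simp
      have "(transpose_mat ?A *\<^sub>v v) $ k = (\<Sum>i<?n. c (f i) * sigma_pi P D (f i) (g k))"
        using k by (simp add: v_def scalar_prod_def atLeast0LessThan mult.commute)
      also have "\<dots> = (\<Sum>W\<in>\<Gamma>. c W * sigma_pi P D W (g k))"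
        by (rule sum.reindex_bij_betw[OF f])
      finally show "(transpose_mat ?A *\<^sub>v v) $ k = 0\<^sub>v ?n $ k" using bspec[OF c(2) gt[OF k]] k by simp
    qed simp
    moreover have "v \<in> carrier_vec ?n" unfolding v_def by simp
    ultimately have "det (transpose_mat ?A) = 0"
      using det_0_iff_vec_prod_zero[of "transpose_mat ?A" ?n] A by auto
    thus ?thesis using det_transpose[OF A] by simp
  qed
qed

end
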